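(* Let $\gamma>0$, and let $\beta\ge0$ and $h_0\in\mathbb R$ be such that $\mathrm f^q(\beta,h_0)=0$. (1) If there exists $c>0$ such that $$\liminf_{N\to\infty}\mathbb P\Big[\mathbf P_N^{\beta,h_0,\omega}\big(|\tau\cap[0,N]|>N^\gamma\big)>c\Big]>c,$$ then $h_c(\beta)=h_0$ and for any $\theta>\gamma^{-1}$, $$\liminf_{h\to h_0^+}\mathrm f^q(\beta,h)\,(h-h_0)^{-\theta}=\infty .$$ (2) If there exists $c>0$ such that $$\limsup_{N\to\infty}\mathbb P\Big[\mathbf P_N^{\beta,h_0,\omega}\big(|\tau\cap[0,N]|>N^\gamma\big)>c\Big]>c,$$ then $h_c(\beta)=h_0$ and for any $\theta>\gamma^{-1}$, $$\limsup_{h\to h_0^+}\mathrm f^q(\beta,h)\,(h-h_0)^{-\theta}=\infty .$$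
   Context: Renewal process. Under the law $\mathbf P$ (expectation $\mathbf E$), $\tau=(\tau_n)_{n\ge 0}$ is a renewal sequence: $\tau_0=0$ and the increments $\tau_{n+1}-\tau_n$ (conditioned on $\tau_n<\infty$) are i.i.d. with values in $\{1,2,\dots\}\cup\{\infty\}$; $\tau$ may contain only finitely many finite terms (i.e. $\sum_{n\ge1}\mathbf P(\tau_1=n)\le 1$). $\tau$ is also viewed as the random subset $\{\tau_k:\tau_k<\infty\}$ of $\{0,1,2,\dots\}$. Throughout, $\mathbf P(\tau_1=n)=L(n)/n^{1+\alpha}$ for all integers $n\ge1$, where $\alpha>0$ and $L:(0,\infty)\to(0,\infty)$ is slowly varying, i.e. measurable with $\lim_{x\to\infty}L(xu)/L(x)=1$ for all $u>0$. Environment. $\omega=(\omega_n)_{n\ge1}$ is a sequence of i.i.d. real random variables (law $\mathbb P$, expectation $\mathbb E$), independent of $\tau$, with mean $0$, variance $1$ and exponential moments: $\lambda(\beta):=\log\mathbb E[\exp(\beta\omega_1)]<\infty$ for all $\beta\ge 0$. Model. For $\beta\ge0$, $h\in\mathbb R$, $N\ge1$, the pinning measure $\mathbf P_N^{\beta,h,\omega}$ on $\tau$ is defined by $$\frac{\mathrm d\mathbf P_N^{\beta,h,\omega}}{\mathrm d\mathbf P}(\tau):=\frac1{Z_N^{\beta,h,\omega}}\exp\Big(\sum_{n=1}^N(h+\beta\omega_n)\mathbf 1_{\{n\in\tau\}}\Big),\qquad Z_N^{\beta,h,\omega}:=\mathbf E\Big[\exp\Big(\sum_{n=1}^N(h+\beta\omega_n)\mathbf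 1_{\{n\in\tau\}}\Big)\Big].$$ The quenched free energy is $\mathrm f^q(\beta,h):=\lim_{N\to\infty}\frac1N\mathbb E\log Z_N^{\beta,h,\omega}=\lim_{N\to\infty}\frac1N\log Z_N^{\beta,h,\omega}$ (the limits exist, the second one $\mathbb P$-a.s.). It is non-negative, and convex and non-decreasing in $h$. The quenched critical point is $h_c(\beta):=\inf\{h:\mathrm f^q(\beta,h)>0\}$. *)

theory Defs
  imports "HOL-Probability.Probability"
begin

definition slowly_varying :: "(real \<Rightarrow> real) \<Rightarrow> bool" where
  "slowly_varying L \<longleftrightarrow>
     (\<forall>x>0. L x > 0) \<and>
     L \<in> borel_measurable (restrict_space borel {0<..}) \<and>
     (\<forall>u>0. ((\<lambda>x. L (x * u) / L x) \<longlongrightarrow> 1) at_top)"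

text \<open>
  A renewal sequence with values in \<open>{0, 1, 2, \<dots>} \<union> {\<infinity>}\<close>. The increments are required to be
  independent and identically distributed only conditionally on finiteness: given any finite
  history \<open>\<tau>\<^sub>0 = s\<^sub>0, \<dots>, \<tau>\<^sub>n = s\<^sub>n\<close>, the increment \<open>\<tau>\<^sub>n\<^sub>+\<^sub>1 - \<tau>\<^sub>n\<close> has the law
  of \<open>\<tau>\<^sub>1\<close>. It suffices to say this for finite increments \<open>k\<close>; the conditional probability of an
  infinite increment is the missing mass, which may be positive.
\<close>

locale renewal_process = P: prob_space P
  for P :: "'t measure" +
  fixes \<tau> :: "nat \<Rightarrow> 't \<Rightarrow> enat"
  assumes measurable_renewal: "\<And>n. \<tau> n \<in> measurable P (count_space UNIV)"
    and renewal_zero: "AE t in P. \<tau> 0 t = 0"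
    and renewal_increasing: "\<And>n. AE t in P. \<tau> n t \<noteq> \<infinity> \<longrightarrow> \<tau> n t < \<tau> (Suc n) t"
    and renewal_terminated: "\<And>n. AE t in P. \<tau> n t = \<infinity> \<longrightarrow> \<tau> (Suc n) t = \<infinity>"
    and renewal_increments: "\<And>n (s :: nat \<Rightarrow> nat) k.
      P.prob {t \<in> space P. (\<forall>i\<le>n. \<tau> i t = enat (s i)) \<and> \<tau> (Suc n) t = enat (s n + k)} =
      P.prob {t \<in> space P. \<forall>i\<le>n. \<tau> i t = enat (s i)} * P.prob {t \<in> space P. \<tau> 1 t = enat k}"

text \<open>
  The environment is the family of the \<open>\<omega> n\<close> with \<open>n \<ge> 1\<close>; \<open>\<omega> 0\<close> is unconstrained and unused.
\<close>

locale iid_environment = Q: prob_space Q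
  for Q :: "'w measure" +
  fixes \<omega> :: "nat \<Rightarrow> 'w \<Rightarrow> real"
  assumes environment_indep: "Q.indep_vars (\<lambda>_. borel) \<omega> {1..}"
    and environment_ident: "\<And>n. n \<ge> 1 \<Longrightarrow> distr Q borel (\<omega> n) = distr Q borel (\<omega> 1)"
    and environment_integrable: "integrable Q (\<omega> 1)" "integrable Q (\<lambda>w. (\<omega> 1 w)\<^sup>2)"
    and environment_mean: "Q.expectation (\<omega> 1) = 0"
    and environment_variance: "Q.variance (\<omega> 1) = 1"
    and environment_exp_moments: "\<And>\<beta>. \<beta> \<ge> 0 \<Longrightarrow> integrable Q (\<lambda>w. exp (\<beta> * \<omega> 1 w))"

text \<open>
  The renewal and the environment live on separate probability spaces, i.e. they are independent
  coordinates of the product space; all quenched quantities integrate over one coordinate at a time.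
\<close>

locale pinning_model = renewal_process P \<tau> + iid_environment Q \<omega>
  for P :: "'t measure" and \<tau> :: "nat \<Rightarrow> 't \<Rightarrow> enat"
    and Q :: "'w measure" and \<omega> :: "nat \<Rightarrow> 'w \<Rightarrow> real" +
  fixes \<alpha> :: real and L :: "real \<Rightarrow> real"
  assumes alpha_pos: "\<alpha> > 0"
    and L_slowly_varying: "slowly_varying L"
    and renewal_law: "\<And>n::nat. n \<ge> 1 \<Longrightarrow>
      P.prob {t \<in> space P. \<tau> 1 t = enat n} = L (real n) / real n powr (1 + \<alpha>)"

definition renewal_set :: "(nat \<Rightarrow> 't \<Rightarrow> enat) \<Rightarrow> 't \<Rightarrow> nat set" where
  "renewal_set \<tau> t = {n. \<exists>k. \<tau> k t = enat n}"

text \<open>In the next three definitions \<open>v\<close> is a fixed realisation of the environment.\<close>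

definition pinning_weight ::
    "(nat \<Rightarrow> 't \<Rightarrow> enat) \<Rightarrow> real \<Rightarrow> real \<Rightarrow> (nat \<Rightarrow> real) \<Rightarrow> nat \<Rightarrow> 't \<Rightarrow> real" where
  "pinning_weight \<tau> \<beta> h v N t =
     exp (\<Sum>n=1..N. (h + \<beta> * v n) * indicator (renewal_set \<tau> t) n)"

definition partition_function ::
    "'t measure \<Rightarrow> (nat \<Rightarrow> 't \<Rightarrow> enat) \<Rightarrow> real \<Rightarrow> real \<Rightarrow> (nat \<Rightarrow> real) \<Rightarrow> nat \<Rightarrow> real" where
  "partition_function P \<tau> \<beta> h v N = (\<integral>t. pinning_weight \<tau> \<beta> h v N t \<partial>P)"

definition pinning_measure ::
    "'t measure \<Rightarrow> (nat \<Rightarrow> 't \<Rightarrow> enat) \<Rightarrow> real \<Rightarrow> real \<Rightarrow> (nat \<Rightarrow> real) \<Rightarrow> nat \<Rightarrow> 't measure" where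
  "pinning_measure P \<tau> \<beta> h v N =
     density P (\<lambda>t. ennreal (pinning_weight \<tau> \<beta> h v N t / partition_function P \<tau> \<beta> h v N))"

definition quenched_free_energy ::
    "'t measure \<Rightarrow> (nat \<Rightarrow> 't \<Rightarrow> enat) \<Rightarrow> 'w measure \<Rightarrow> (nat \<Rightarrow> 'w \<Rightarrow> real) \<Rightarrow> real \<Rightarrow> real \<Rightarrow> real" where
  "quenched_free_energy P \<tau> Q \<omega> \<beta> h =
     lim (\<lambda>N. (\<integral>w. ln (partition_function P \<tau> \<beta> h (\<lambda>n. \<omega> n w) N) \<partial>Q) / real N)"

definition quenched_critical_point ::
    "'t measure \<Rightarrow> (nat \<Rightarrow> 't \<Rightarrow> enat) \<Rightarrow> 'w measure \<Rightarrow> (nat \<Rightarrow> 'w \<Rightarrow> real) \<Rightarrow> real \<Rightarrow> real" where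
  "quenched_critical_point P \<tau> Q \<omega> \<beta> = Inf {h. quenched_free_energy P \<tau> Q \<omega> \<beta> h > 0}"

text \<open>
  \<open>many_contacts_prob P \<tau> Q \<omega> \<beta> h \<gamma> c N\<close> is the probability, over the environment, that the pinning
  measure gives mass greater than \<open>c\<close> to the event \<open>|\<tau> \<inter> [0, N]| > N\<^sup>\<gamma>\<close>.
\<close>

definition many_contacts_prob ::
    "'t measure \<Rightarrow> (nat \<Rightarrow> 't \<Rightarrow> enat) \<Rightarrow> 'w measure \<Rightarrow> (nat \<Rightarrow> 'w \<Rightarrow> real) \<Rightarrow>
     real \<Rightarrow> real \<Rightarrow> real \<Rightarrow> real \<Rightarrow> nat \<Rightarrow> real" where
  "many_contacts_prob P \<tau> Q \<omega> \<beta> h \<gamma> c N =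
     measure Q {w \<in> space Q.
       measure (pinning_measure P \<tau> \<beta> h (\<lambda>n. \<omega> n w) N)
         {t \<in> space P. real (card (renewal_set \<tau> t \<inter> {0..N})) > real N powr \<gamma>} > c}"

end

theory Submission
  imports Defs "HOL-Real_Asymp.Real_Asymp"
begin

text \<open>
  Write \<open>Z\<^sub>N(h)\<close> for the partition function and \<open>f(h)\<close> for the free energy. Raising the field from \<open>h\<^sub>0\<close> to \<open>h\<^sub>0 + \<delta>\<close> multiplies the weight of a path by
  \<open>exp (\<delta> k)\<close>, where \<open>k\<close> is its number of contacts in \<open>[1, N]\<close>. If the pinning measure at \<open>h\<^sub>0\<close>
  puts mass at least \<open>c\<close> on paths with more than \<open>N\<^sup>\<gamma>\<close> contacts, and this happens with probability
  at least \<open>c\<close>, then the mean of \<open>ln Z\<^sub>N\<close> grows by about \<open>c \<delta> N\<^sup>\<gamma>\<close>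
  (\<open>partition_function_tilt\<close>, \<open>mean_ln_partition_gain\<close>).
  
  This finite-volume gain passes to the infinite volume because logarithmic errors are the only
  loss. The partition function constrained to have a contact at \<open>N\<close> is supermultiplicative along
  shifts of the environment, so by stationarity its mean logarithm is superadditive, and by Fekete's
  lemma that mean divided by \<open>N\<close> is a lower bound for \<open>f\<close> at every single \<open>N\<close>. The price of
  constraining the end point is one extra jump from the last contact to \<open>N + 1\<close>: its probability
  is at least a negative power of \<open>N\<close>, since a slowly varying function is bounded below by such a power
  (\<open>slowly_varying_ln_lower_bound\<close>), and the disorder at \<open>N + 1\<close> has mean zero. Hence
  (\<open>quenched_free_energy_gain\<close>)
  
    \<open>f(h\<^sub>0 + \<delta>) \<ge> (c \<delta> (N\<^sup>\<gamma> - 1) - C (1 + ln (N + 1))) / (N + 1)\<close>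
  
  for each \<open>N\<close> at which the contact condition holds, with \<open>C\<close> independent of \<open>N\<close> and \<open>\<delta>\<close>.
  
  Given \<open>\<theta> > 1/\<gamma>\<close>, choose \<open>s\<close> strictly between \<open>1/\<gamma>\<close> and \<open>\<theta>\<close>, and couple \<open>\<delta>\<close> and \<open>N\<close> by
  \<open>N \<approx> \<delta>\<^sup>-\<^sup>s\<close>. Then \<open>\<delta> N\<^sup>\<gamma>\<close> is a positive power of \<open>N\<close> and beats the logarithm, so
  \<open>f(h\<^sub>0 + \<delta>) \<ge> 1 / (N + 1)\<close>, which is of order \<open>\<delta>\<^sup>s\<close> and much larger than \<open>\<delta>\<^sup>\<theta>\<close>. If the condition
  holds for all large \<open>N\<close>, this covers all small \<open>\<delta>\<close> and gives the lower limit; if it holds for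
  infinitely many \<open>N\<close>, it covers a sequence of \<open>\<delta>\<close> tending to \<open>0\<close> and gives the upper limit. In both
  cases monotonicity of \<open>f\<close> shows that \<open>f > 0\<close> exactly on the right of \<open>h\<^sub>0\<close>.
\<close>

section \<open>Superadditive sequences\<close>

text \<open>
  Divide \<open>n\<close> by \<open>M\<close> with remainder; the \<open>n div M\<close> full blocks contribute \<open>a M\<close> each, and the
  finitely many possible remainders are absorbed in the constant \<open>B\<close>.
\<close>

lemma superadditive_linear_lower_bound:
  fixes a :: "nat \<Rightarrow> real"
  assumes super: "\<And>m n. a (m + n) \<ge> a m + a n" and M: "M \<ge> 1"
  shows "\<exists>B. \<forall>n. a n \<ge> real n * (a M / real M) - B"
proof -
  have mult: "a (q * M + r) \<ge> real q * a M + a r" for q r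
  proof (induction q)
    case (Suc q)
    have "a (Suc q * M + r) \<ge> a M + a (q * M + r)"
      using super[of M "q * M + r"] by (simp add: add.assoc)
    with Suc show ?case by (simp add: algebra_simps)
  qed simp
  define B where "B = \<bar>a M\<bar> + (\<Sum>r<M. \<bar>a r\<bar>)"
  have "a n \<ge> real n * (a M / real M) - B" for n
  proof -
    have r: "n mod M < M" using M by simp
    have "a n \<ge> real (n div M) * a M + a (n mod M)"
      using mult[of "n div M" "n mod M"] by simp
    moreover have "\<bar>a (n mod M)\<bar> \<le> (\<Sum>r<M. \<bar>a r\<bar>)"
      by (rule member_le_sum) (use r in auto)
    moreover have "real (n div M) * a M = real n * (a M / real M) - (real (n mod M) / real M) * a M"
    proof -
      have "real n = real (n div M) * real M + real (n mod M)"
        by (metis div_mult_mod_eq of_nat_add of_nat_mult)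
      then show ?thesis using M by (simp add: field_simps)
    qed
    moreover have "\<bar>(real (n mod M) / real M) * a M\<bar> \<le> 1 * \<bar>a M\<bar>"
      unfolding abs_mult using r by (intro mult_right_mono) auto
    ultimately show ?thesis unfolding B_def by linarith
  qed
  then show ?thesis by blast
qed

text \<open>
  The limit is the supremum of the quotients, so each single quotient bounds it from below. This is
  what turns an estimate at one finite volume into an estimate of the free energy.
\<close>

lemma fekete_superadditive:
  fixes a :: "nat \<Rightarrow> real"
  assumes super: "\<And>m n. a (m + n) \<ge> a m + a n" and ub: "\<And>n. a n \<le> C * real n"
  shows "\<exists>l. (\<lambda>n. a n / real n) \<longlonglongrightarrow> l \<and> (\<forall>n\<ge>1. a n / real n \<le> l)"
proof -
  define l where "l = (SUP n\<in>{1..}. a n / real n)"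
  have bdd: "bdd_above ((\<lambda>n. a n / real n) ` {1..})"
    by (rule bdd_aboveI[of _ C]) (use ub in \<open>auto simp: divide_simps\<close>)
  have le: "a n / real n \<le> l" if "n \<ge> 1" for n
    unfolding l_def by (rule cSUP_upper[OF _ bdd]) (use that in auto)
  have "(\<lambda>n. a n / real n) \<longlonglongrightarrow> l"
  proof (rule order_tendstoI)
    fix y assume "y < l"
    then obtain M where M: "M \<ge> 1" "y < a M / real M"
      unfolding l_def using less_cSUP_iff[OF _ bdd, of y] by auto
    obtain B where B: "\<And>n. a n \<ge> real n * (a M / real M) - B"
      using superadditive_linear_lower_bound[of a, OF super M(1)] by blast
    have "(\<lambda>n. a M / real M - B / real n) \<longlonglongrightarrow> a M / real M - 0"
      by (intro tendsto_intros tendsto_divide_0[OF tendsto_const]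
          filterlim_at_top_imp_at_infinity filterlim_real_sequentially)
    then have "\<forall>\<^sub>F n in sequentially. y < a M / real M - B / real n"
      using M(2) by (auto dest: order_tendstoD(1))
    then show "\<forall>\<^sub>F n in sequentially. y < a n / real n"
      using eventually_ge_at_top[of 1]
    proof eventually_elim
      case (elim n)
      have "a M / real M - B / real n = (real n * (a M / real M) - B) / real n"
        using elim(2) by (simp add: diff_divide_distrib)
      also have "\<dots> \<le> a n / real n" by (intro divide_right_mono B) simp
      finally show ?case using elim(1) by linarith
    qed
  next
    fix y assume "l < y"
    show "\<forall>\<^sub>F n in sequentially. a n / real n < y"
      using eventually_ge_at_top[of 1]
    proof eventually_elim
      case (elim n)
      with le[of n] \<open>l < y\<close> show ?case by simp
    qed
  qed
  with le show ?thesis by blast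
qed

section \<open>Lower bound for slowly varying functions\<close>

text \<open>
  A weak form of the uniform convergence theorem for slowly varying functions, in additive notation.
  If the bound failed along points \<open>x\<^sub>n\<close> with offsets \<open>u\<^sub>n\<close>, then for each \<open>v\<close> in \<open>[1, 2]\<close> one of the
  increments from \<open>x\<^sub>n\<close> and from \<open>x\<^sub>n + u\<^sub>n\<close> to \<open>x\<^sub>n + v\<close> would exceed \<open>1/2\<close> in absolute value. But both increments tend
  to \<open>0\<close> pointwise in the offset, hence, once truncated at \<open>1\<close>, also in mean over a bounded interval.
\<close>

lemma vanishing_increments_bounded:
  fixes f :: "real \<Rightarrow> real"
  assumes f [measurable]: "f \<in> borel_measurable borel"
    and lim: "\<And>u. ((\<lambda>x. f (x + u) - f x) \<longlongrightarrow> 0) at_top"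
  shows "\<exists>X. \<forall>x\<ge>X. \<forall>u\<in>{0..1}. \<bar>f (x + u) - f x\<bar> \<le> 1"
proof (rule ccontr)
  assume "\<not> ?thesis"
  then have "\<forall>n::nat. \<exists>x u. x \<ge> real n \<and> u \<in> {0..1} \<and> \<bar>f (x + u) - f x\<bar> > 1"
    by (meson not_le)
  then obtain x u where x: "\<And>n. x n \<ge> real n" and u: "\<And>n. u n \<in> {0..1}"
    and big: "\<And>n. \<bar>f (x n + u n) - f (x n)\<bar> > 1"
    by metis
  have small: "(\<lambda>n. \<integral>v. indicator {0..2} v * min 1 \<bar>f (z n + v) - f (z n)\<bar> \<partial>lborel) \<longlonglongrightarrow> 0"
    if z: "\<And>n. z n \<ge> real n" for z :: "nat \<Rightarrow> real"
  proof -
    have "filterlim z at_top sequentially"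
      by (rule filterlim_at_top_mono[OF filterlim_real_sequentially]) (simp add: z)
    then have "(\<lambda>n. f (z n + v) - f (z n)) \<longlonglongrightarrow> 0" for v
      using filterlim_compose[OF lim] by blast
    then have "(\<lambda>n. indicator {0..2} v * min 1 \<bar>f (z n + v) - f (z n)\<bar>)
        \<longlonglongrightarrow> indicator {0..2} v * min 1 \<bar>0\<bar>" for v :: real
      by (intro tendsto_intros)
    then have "(\<lambda>n. indicator {0..2} v * min 1 \<bar>f (z n + v) - f (z n)\<bar>) \<longlonglongrightarrow> 0" for v :: real
      by simp
    then have "(\<lambda>n. \<integral>v. indicator {0..2} v * min 1 \<bar>f (z n + v) - f (z n)\<bar> \<partial>lborel)
        \<longlonglongrightarrow> (\<integral>v. 0 \<partial>(lborel :: real measure))"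
      by (intro integral_dominated_convergence[where w="indicator {0..2}"])
         (auto simp: indicator_def)
    then show ?thesis by simp
  qed
  \<comment> \<open>The interval \<open>[0, 2]\<close> contains both \<open>v\<close> and \<open>v - u\<^sub>n\<close> for every \<open>v\<close> in \<open>[1, 2]\<close>.\<close>
  define A where "A z = (\<integral>v. indicator {0..2} v * min 1 \<bar>f (z + v) - f z\<bar> \<partial>lborel)" for z
  have int: "integrable lborel (\<lambda>v. indicator {0..2} v * min 1 \<bar>f (z + v) - f z\<bar>)" for z
    by (rule Bochner_Integration.integrable_bound[of _ "indicator {0..2::real}"])
       (auto simp: indicator_def)
  have "A (x n) + A (x n + u n) \<ge> 1" for n
  proof -
    let ?g = "\<lambda>v. indicator {0..2} v * min 1 \<bar>f (x n + v) - f (x n)\<bar>"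
    let ?k = "\<lambda>v. indicator {0..2} v * min 1 \<bar>f (x n + u n + v) - f (x n + u n)\<bar>"
    have k_shift: "integrable lborel (\<lambda>v. ?k (- u n + 1 * v))"
      "(\<integral>v. ?k v \<partial>lborel) = (\<integral>v. ?k (- u n + 1 * v) \<partial>lborel)"
      using lborel_integrable_real_affine[OF int[of "x n + u n"], of 1 "- u n"]
        lborel_integral_real_affine[of 1 ?k "- u n"] by simp_all
    have "(1::real) = (\<integral>v. indicator {1..2} v \<partial>(lborel :: real measure))" by simp
    also have "\<dots> \<le> (\<integral>v. ?g v + ?k (- u n + 1 * v) \<partial>lborel)"
    proof (rule integral_mono)
      fix v :: real
      show "indicator {1..2} v \<le> ?g v + ?k (- u n + 1 * v)"
      proof (cases "v \<in> {1..2}")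
        case True
        with u[of n] have "v \<in> {0..2}" "- u n + 1 * v \<in> {0..2}" by auto
        moreover have "min 1 \<bar>a\<bar> + min 1 \<bar>b\<bar> \<ge> 1" if "\<bar>a - b\<bar> > 1" for a b :: real
          using that by linarith
        from this[of "f (x n + v) - f (x n)" "f (x n + v) - f (x n + u n)"] big[of n]
        have "1 \<le> min 1 \<bar>f (x n + v) - f (x n)\<bar> + min 1 \<bar>f (x n + v) - f (x n + u n)\<bar>"
          by simp
        ultimately show ?thesis using True by (simp add: algebra_simps)
      qed simp
    qed (use int k_shift in auto)
    also have "\<dots> = A (x n) + A (x n + u n)"
      unfolding A_def using int[of "x n"] k_shift by (subst Bochner_Integration.integral_add) auto
    finally show ?thesis .
  qed
  moreover have "(\<lambda>n. A (x n) + A (x n + u n)) \<longlonglongrightarrow> 0 + 0"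
    unfolding A_def using x u by (intro tendsto_add small) (auto intro: add_increasing2)
  ultimately show False
    using LIMSEQ_le_const[of _ 0 1] by fastforce
qed

text \<open>
  Beyond some \<open>X\<close> the function \<open>ln L(exp x)\<close> drops by at most \<open>1\<close> on each unit interval, hence at
  most linearly in \<open>x\<close>. The finitely many integers below \<open>exp X\<close> are absorbed in the constant.
\<close>

lemma slowly_varying_ln_lower_bound:
  assumes "slowly_varying L"
  shows "\<exists>C\<ge>0. \<forall>n\<ge>1::nat. ln (L (real n)) \<ge> - C * (1 + ln (real n))"
proof -
  define f where "f x = ln (L (exp x))" for x
  have pos: "L x > 0" if "x > 0" for x using assms that by (auto simp: slowly_varying_def)
  have [measurable]: "L \<in> borel_measurable (restrict_space borel {0<..})"
    using assms by (auto simp: slowly_varying_def)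
  have [measurable]: "exp \<in> measurable borel (restrict_space borel {(0::real)<..})"
    by (rule measurable_restrict_space2) auto
  have "f \<in> borel_measurable borel"
    unfolding f_def by measurable
  moreover have "((\<lambda>x. f (x + u) - f x) \<longlongrightarrow> 0) at_top" for u
  proof -
    have "((\<lambda>x. L (x * exp u) / L x) \<longlongrightarrow> 1) at_top"
      using assms by (auto simp: slowly_varying_def)
    then have "((\<lambda>x. L (exp x * exp u) / L (exp x)) \<longlongrightarrow> 1) at_top"
      using filterlim_compose[OF _ exp_at_top] by blast
    then have "((\<lambda>x. ln (L (exp x * exp u) / L (exp x))) \<longlongrightarrow> ln 1) at_top"
      by (intro tendsto_ln) auto
    then show ?thesis by (simp add: f_def ln_div pos exp_add less_imp_neq[symmetric])
  qed
  ultimately obtain X0 where X0: "\<And>x u. x \<ge> X0 \<Longrightarrow> u \<in> {0..1} \<Longrightarrow> \<bar>f (x + u) - f x\<bar> \<le> 1"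
    using vanishing_increments_bounded[of f] by blast
  define X where "X = max X0 0"
  have X: "\<bar>f (x + u) - f x\<bar> \<le> 1" if "x \<ge> X" "u \<in> {0..1}" for x u
    using X0[of x u] that by (auto simp: X_def)
  have step: "f (X + real m) \<ge> f X - real m" for m
  proof (induction m)
    case (Suc m)
    with X[of "X + real m" 1] show ?case by (auto simp: algebra_simps)
  qed simp
  have tail: "f x \<ge> - \<bar>f X\<bar> - 1 - x" if "x \<ge> X" for x
  proof -
    define m where "m = nat \<lfloor>x - X\<rfloor>"
    have m: "real m \<le> x - X" "x - X \<le> real m + 1"
      unfolding m_def using that by linarith+
    with X[of "X + real m" "x - X - real m"] step[of m] that show ?thesis
      by (auto simp: X_def)
  qed
  define C where "C = \<bar>f X\<bar> + 1 + (\<Sum>n\<le>nat \<lceil>exp X\<rceil>. \<bar>ln (L (real n))\<bar>)"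
  have C1: "C \<ge> \<bar>f X\<bar> + 1" unfolding C_def by (simp add: sum_nonneg)
  have "ln (L (real n)) \<ge> - C * (1 + ln (real n))" if n: "n \<ge> 1" for n :: nat
  proof (cases "ln (real n) \<ge> X")
    case True
    have "1 * ln (real n) \<le> C * ln (real n)" using C1 n by (intro mult_right_mono) auto
    with tail[OF True] C1 n show ?thesis by (simp add: f_def algebra_simps)
  next
    case False
    then have "real n < exp X" using n by (metis exp_ln exp_less_mono not_le of_nat_0_less_iff less_le_trans zero_less_one)
    then have "n \<le> nat \<lceil>exp X\<rceil>" by linarith
    then have "\<bar>ln (L (real n))\<bar> \<le> (\<Sum>n\<le>nat \<lceil>exp X\<rceil>. \<bar>ln (L (real n))\<bar>)"
      by (intro member_le_sum) auto
    then have "\<bar>ln (L (real n))\<bar> \<le> C * 1" unfolding C_def by simp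
    also have "\<dots> \<le> C * (1 + ln (real n))" using C1 n by (intro mult_left_mono) auto
    finally show ?thesis by simp
  qed
  with C1 show ?thesis by (intro exI[of _ C]) auto
qed

section \<open>Renewal decomposition of the constrained partition function\<close>

context renewal_process
begin

definition regular_path :: "'t \<Rightarrow> bool" where
  "regular_path t \<longleftrightarrow> \<tau> 0 t = 0 \<and>
     (\<forall>n. (\<tau> n t \<noteq> \<infinity> \<longrightarrow> \<tau> n t < \<tau> (Suc n) t) \<and> (\<tau> n t = \<infinity> \<longrightarrow> \<tau> (Suc n) t = \<infinity>))"

lemma AE_regular_path: "AE t in P. regular_path t"
  unfolding regular_path_def AE_conj_iff AE_all_countable
  using renewal_zero renewal_increasing renewal_terminated by blast

lemma renewal_less:
  assumes "regular_path t" "\<tau> n t = enat k" "i < n"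
  shows "\<exists>s<k. \<tau> i t = enat s"
  using assms(2,3)
proof (induction n arbitrary: k)
  case (Suc n)
  have "\<tau> n t \<noteq> \<infinity>"
    using assms(1) Suc.prems(1) unfolding regular_path_def by (metis enat.distinct(1))
  then obtain m where m: "\<tau> n t = enat m" by auto
  then have "m < k"
    using assms(1) Suc.prems(1) unfolding regular_path_def
    by (metis enat.distinct(1) enat_ord_simps(2))
  show ?case
  proof (cases "i = n")
    case True
    with m \<open>m < k\<close> show ?thesis by blast
  next
    case False
    with Suc.prems(2) have "i < n" by simp
    from Suc.IH[OF m this] obtain s where "s < m" "\<tau> i t = enat s" by blast
    with \<open>m < k\<close> show ?thesis by (intro exI[of _ s]) simp
  qed
qed simp

lemma renewal_inj:
  assumes "regular_path t" "\<tau> n t = enat k" "\<tau> m t = enat k"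
  shows "n = m"
  using renewal_less[OF assms(1,2), of m] renewal_less[OF assms(1,3), of n] assms(2,3)
  by (cases n m rule: linorder_cases) auto

lemma index_le_renewal:
  assumes "regular_path t" "\<tau> n t = enat k"
  shows "n \<le> k"
  using assms(2)
proof (induction n arbitrary: k)
  case (Suc n)
  obtain s where s: "s < k" "\<tau> n t = enat s"
    using renewal_less[OF assms(1) Suc.prems, of n] by auto
  with Suc.IH[OF s(2)] show ?case by simp
qed simp

lemma renewal_set_between:
  assumes "regular_path t" "\<tau> n t = enat k" "\<tau> (Suc n) t = enat N" "k < j" "j < N"
  shows "j \<notin> renewal_set \<tau> t"
proof
  assume "j \<in> renewal_set \<tau> t"
  then obtain m where m: "\<tau> m t = enat j" by (auto simp: renewal_set_def)
  have "m < Suc n"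
    using renewal_less[OF assms(1) m, of "Suc n"] assms(3,5) m
    by (cases m "Suc n" rule: linorder_cases) auto
  moreover have "n < m"
    using renewal_less[OF assms(1,2), of m] assms(2,4) m
    by (cases m n rule: linorder_cases) auto
  ultimately show False by simp
qed

text \<open>
  Only the first \<open>k + 1\<close> renewal points can equal \<open>k\<close>, so finitely many indices suffice. The upper
  limit \<open>N\<close> is left free so that one range of summation serves all \<open>k < N\<close> at once.
\<close>

lemma indicator_renewal_set:
  assumes "regular_path t" "k < N"
  shows "indicator (renewal_set \<tau> t) k = (\<Sum>n<N. of_bool (\<tau> n t = enat k) :: real)"
proof (cases "k \<in> renewal_set \<tau> t")
  case True
  then obtain m where m: "\<tau> m t = enat k" by (auto simp: renewal_set_def)
  then have eq: "\<tau> n t = enat k \<longleftrightarrow> n = m" for n using renewal_inj[OF assms(1)] by blast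
  have "m < N" using index_le_renewal[OF assms(1) m] assms(2) by simp
  with True show ?thesis by (simp add: eq of_bool_def)
qed (auto simp: renewal_set_def)

lemma zero_in_renewal_set: "regular_path t \<Longrightarrow> 0 \<in> renewal_set \<tau> t"
  by (auto simp: regular_path_def renewal_set_def zero_enat_def)

lemma renewal_eq_sets [measurable]: "{t \<in> space P. \<tau> n t = x} \<in> sets P"
  using measurable_sets[OF measurable_renewal[of n], of "{x}"]
  by (simp add: vimage_def Int_def conj_commute)

lemma pred_renewal [measurable]: "Measurable.pred P (\<lambda>t. \<tau> n t = x)"
  using renewal_eq_sets by (simp add: pred_def)

lemma pred_renewal_set [measurable]: "Measurable.pred P (\<lambda>t. j \<in> renewal_set \<tau> t)"
  unfolding renewal_set_def mem_Collect_eq by measurable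

lemma indicator_renewal_set_measurable [measurable]:
  "(\<lambda>t. indicator (renewal_set \<tau> t) j :: real) \<in> borel_measurable P"
  unfolding indicator_def by measurable

lemma pinning_weight_measurable [measurable]: "pinning_weight \<tau> \<beta> h v N \<in> borel_measurable P"
  unfolding pinning_weight_def by measurable

lemma pinning_weight_pos: "pinning_weight \<tau> \<beta> h v N t > 0"
  by (simp add: pinning_weight_def)

lemma pinning_weight_le:
  "pinning_weight \<tau> \<beta> h v N t \<le> exp (\<Sum>n=1..N. \<bar>h\<bar> + \<beta> * \<bar>v n\<bar>)" if "\<beta> \<ge> 0"
  unfolding pinning_weight_def exp_le_cancel_iff
proof (rule sum_mono)
  fix n
  have "(h + \<beta> * v n) \<le> \<bar>h\<bar> + \<beta> * \<bar>v n\<bar>"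
    using that by (intro add_mono mult_left_mono) auto
  moreover have "0 \<le> \<bar>h\<bar> + \<beta> * \<bar>v n\<bar>" using that by simp
  ultimately show "(h + \<beta> * v n) * indicator (renewal_set \<tau> t) n \<le> \<bar>h\<bar> + \<beta> * \<bar>v n\<bar>"
    by (auto simp: indicator_def)
qed

lemma pinning_weight_bounded: "\<exists>B. \<forall>t. \<bar>pinning_weight \<tau> \<beta> h v N t\<bar> \<le> B"
proof -
  have "\<bar>pinning_weight \<tau> \<beta> h v N t\<bar> \<le> exp (\<Sum>n=1..N. \<bar>h + \<beta> * v n\<bar>)" for t
    unfolding pinning_weight_def abs_exp_cancel exp_le_cancel_iff
    by (intro sum_mono) (auto simp: indicator_def)
  then show ?thesis by blast
qed

lemma integrable_pinning_weight_times:
  assumes "g \<in> borel_measurable P" "\<And>t. \<bar>g t\<bar> \<le> 1"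
  shows "integrable P (\<lambda>t. pinning_weight \<tau> \<beta> h v N t * g t)"
proof -
  obtain B where B: "\<And>t. \<bar>pinning_weight \<tau> \<beta> h v N t\<bar> \<le> B"
    using pinning_weight_bounded by blast
  have "\<bar>pinning_weight \<tau> \<beta> h v N t * g t\<bar> \<le> B * 1" for t
    unfolding abs_mult by (intro mult_mono B assms(2)) (use order_trans[OF abs_ge_zero B] in auto)
  then show ?thesis
    by (intro P.integrable_const_bound[of _ B]) (use assms(1) in auto)
qed

lemma integrable_pinning_weight [simp]: "integrable P (pinning_weight \<tau> \<beta> h v N)"
  using integrable_pinning_weight_times[of "\<lambda>_. 1"] by simp

definition constrained_pf :: "real \<Rightarrow> real \<Rightarrow> (nat \<Rightarrow> real) \<Rightarrow> nat \<Rightarrow> real" where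
  "constrained_pf \<beta> h v N =
     (\<integral>t. pinning_weight \<tau> \<beta> h v N t * indicator (renewal_set \<tau> t) N \<partial>P)"

definition gap_prob :: "nat \<Rightarrow> real" where
  "gap_prob n = P.prob {t \<in> space P. \<tau> 1 t = enat n}"

text \<open>
  Up to its \<open>n\<close>-th renewal point, the weight of a path is a function of the history of \<open>n\<close> steps alone.
  This is what makes the renewal property applicable to it.
\<close>

lemma pinning_weight_history:
  assumes "regular_path t" "\<tau> n t = enat k" "\<And>i. i \<le> n \<Longrightarrow> \<tau> i t = enat (s i)"
  shows "pinning_weight \<tau> \<beta> h v k t = exp (\<Sum>j=1..k. (h + \<beta> * v j) * indicator (s ` {..n}) j)"
proof -
  have ind: "indicator (renewal_set \<tau> t) j = (indicator (s ` {..n}) j :: real)" if "j \<le> k" for j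
  proof -
    have "j \<in> renewal_set \<tau> t \<longleftrightarrow> j \<in> s ` {..n}"
    proof
      assume "j \<in> renewal_set \<tau> t"
      then obtain m where m: "\<tau> m t = enat j" by (auto simp: renewal_set_def)
      have "m \<le> n"
        using renewal_less[OF assms(1) m, of n] assms(2) that by (cases "m \<le> n") auto
      with m assms(3) show "j \<in> s ` {..n}" by fastforce
    qed (use assms(3) in \<open>auto simp: renewal_set_def\<close>)
    then show ?thesis by (simp add: indicator_def)
  qed
  show ?thesis
    unfolding pinning_weight_def by (intro arg_cong[of _ _ exp] sum.cong refl, subst ind) auto
qed

text \<open>
  The renewal property for weighted paths: the gap after the \<open>n\<close>-th renewal is independent of the
  weight collected up to it. On \<open>\<tau> n t = enat k\<close> there are only finitely many histories, and on each of
  them the weight is constant, so both sides are finite sums over histories that agree term by term.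
\<close>

lemma pinning_weight_times_next_gap:
  "(\<integral>t. pinning_weight \<tau> \<beta> h v k t * of_bool (\<tau> n t = enat k \<and> \<tau> (Suc n) t = enat (k + m)) \<partial>P) =
   gap_prob m * (\<integral>t. pinning_weight \<tau> \<beta> h v k t * of_bool (\<tau> n t = enat k) \<partial>P)"
proof -
  \<comment> \<open>\<open>S\<close> is the set of candidate histories, \<open>g s\<close> the weight of the history \<open>s\<close>, and \<open>H s\<close> the event that it occurs.\<close>
  define S where "S = {s \<in> {..n} \<rightarrow>\<^sub>E {..k}. s n = k}"
  define g where "g s = exp (\<Sum>j=1..k. (h + \<beta> * v j) * indicator (s ` {..n}) j)" for s
  define H where "H s = {t \<in> space P. \<forall>i\<le>n. \<tau> i t = enat (s i)}" for s :: "nat \<Rightarrow> nat"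
  have [simp]: "finite S"
    unfolding S_def by (rule finite_subset[of _ "{..n} \<rightarrow>\<^sub>E {..k}"]) (auto intro: finite_PiE)
  have [measurable]: "H s \<in> sets P" for s
    unfolding H_def by measurable
  have expand: "pinning_weight \<tau> \<beta> h v k t * of_bool (\<tau> n t = enat k) =
      (\<Sum>s\<in>S. g s * indicator (H s) t)" if t: "regular_path t" "t \<in> space P" for t
  proof (cases "\<tau> n t = enat k")
    case True
    define s0 where "s0 = restrict (\<lambda>i. the_enat (\<tau> i t)) {..n}"
    have fin: "\<exists>s\<le>k. \<tau> i t = enat s" if "i \<le> n" for i
      using renewal_less[OF t(1) True, of i] True that by (cases "i = n") (auto intro: less_imp_le)
    have s0: "\<tau> i t = enat (s0 i)" if "i \<le> n" for i
      using fin[OF that] that by (auto simp: s0_def)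
    have "s0 \<in> S"
      using fin True by (fastforce simp: S_def s0_def)
    have mem: "t \<in> H s \<longleftrightarrow> s = s0" if "s \<in> S" for s
    proof
      assume "t \<in> H s"
      then have "s i = s0 i" if "i \<le> n" for i using s0[OF that] that by (auto simp: H_def)
      moreover have "s i = s0 i" if "\<not> i \<le> n" for i
        using that \<open>s \<in> S\<close> by (auto simp: S_def s0_def PiE_def extensional_def)
      ultimately show "s = s0" by blast
    qed (use s0 t in \<open>auto simp: H_def\<close>)
    have "(\<Sum>s\<in>S. g s * indicator (H s) t) = (\<Sum>s\<in>S. if s = s0 then g s else 0)"
      by (intro sum.cong) (use mem in auto)
    also have "\<dots> = g s0" using \<open>s0 \<in> S\<close> by simp
    also have "\<dots> = pinning_weight \<tau> \<beta> h v k t"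
      unfolding g_def using pinning_weight_history[OF t(1) True s0] by simp
    finally show ?thesis using True by simp
  next
    case False
    then have "t \<notin> H s" if "s \<in> S" for s using that by (auto simp: H_def S_def)
    with False show ?thesis by simp
  qed
  have AEt: "AE t in P. regular_path t \<and> t \<in> space P" using AE_regular_path by auto
  have "(\<integral>t. pinning_weight \<tau> \<beta> h v k t * of_bool (\<tau> n t = enat k) \<partial>P) =
      (\<integral>t. (\<Sum>s\<in>S. g s * indicator (H s) t) \<partial>P)"
  proof (intro integral_cong_AE)
    show "AE t in P. pinning_weight \<tau> \<beta> h v k t * of_bool (\<tau> n t = enat k) =
        (\<Sum>s\<in>S. g s * indicator (H s) t)"
      using AEt by eventually_elim (simp only: expand)
  qed measurable
  also have "\<dots> = (\<Sum>s\<in>S. g s * P.prob (H s))"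
    by (subst Bochner_Integration.integral_sum) (auto simp: P.emeasure_eq_measure)
  finally have 1: "(\<integral>t. pinning_weight \<tau> \<beta> h v k t * of_bool (\<tau> n t = enat k) \<partial>P) =
      (\<Sum>s\<in>S. g s * P.prob (H s))" .
  define H' where "H' s = {t \<in> H s. \<tau> (Suc n) t = enat (k + m)}" for s
  have [measurable]: "H' s \<in> sets P" for s
    unfolding H'_def H_def by measurable
  have "(\<integral>t. pinning_weight \<tau> \<beta> h v k t * of_bool (\<tau> n t = enat k \<and> \<tau> (Suc n) t = enat (k + m)) \<partial>P) =
      (\<integral>t. (\<Sum>s\<in>S. g s * indicator (H' s) t) \<partial>P)"
  proof (intro integral_cong_AE)
    show "AE t in P. pinning_weight \<tau> \<beta> h v k t *
        of_bool (\<tau> n t = enat k \<and> \<tau> (Suc n) t = enat (k + m)) = (\<Sum>s\<in>S. g s * indicator (H' s) t)"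
      using AEt
    proof eventually_elim
      case (elim t)
      have "(\<Sum>s\<in>S. g s * indicator (H' s) t) =
          (\<Sum>s\<in>S. g s * indicator (H s) t) * of_bool (\<tau> (Suc n) t = enat (k + m))"
        unfolding H'_def by (auto simp: indicator_def intro!: sum.cong)
      with expand[of t] elim show ?case by (simp add: of_bool_conj mult.assoc)
    qed
  qed measurable
  also have "\<dots> = (\<Sum>s\<in>S. g s * P.prob (H' s))"
    by (subst Bochner_Integration.integral_sum) (auto simp: P.emeasure_eq_measure)
  also have "\<dots> = (\<Sum>s\<in>S. gap_prob m * (g s * P.prob (H s)))"
  proof (rule sum.cong)
    fix s assume "s \<in> S"
    then have "H' s = {t \<in> space P. (\<forall>i\<le>n. \<tau> i t = enat (s i)) \<and> \<tau> (Suc n) t = enat (s n + m)}"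
      by (auto simp: H'_def H_def S_def)
    then have "P.prob (H' s) = P.prob (H s) * gap_prob m"
      unfolding H_def gap_prob_def using renewal_increments[of n s m] by simp
    then show "g s * P.prob (H' s) = gap_prob m * (g s * P.prob (H s))" by simp
  qed simp
  finally show ?thesis using 1 by (simp add: sum_distrib_left)
qed

lemma constrained_pf_eq_sum:
  assumes "k < N"
  shows "constrained_pf \<beta> h v k = (\<Sum>n<N. \<integral>t. pinning_weight \<tau> \<beta> h v k t * of_bool (\<tau> n t = enat k) \<partial>P)"
proof -
  have "constrained_pf \<beta> h v k =
      (\<integral>t. (\<Sum>n<N. pinning_weight \<tau> \<beta> h v k t * of_bool (\<tau> n t = enat k)) \<partial>P)"
    unfolding constrained_pf_def
  proof (rule integral_cong_AE)
    show "AE t in P. pinning_weight \<tau> \<beta> h v k t * indicator (renewal_set \<tau> t) k =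
        (\<Sum>n<N. pinning_weight \<tau> \<beta> h v k t * of_bool (\<tau> n t = enat k))"
      using AE_regular_path
      by eventually_elim (simp add: indicator_renewal_set[OF _ assms] sum_distrib_left)
  qed measurable
  also have "\<dots> = (\<Sum>n<N. \<integral>t. pinning_weight \<tau> \<beta> h v k t * of_bool (\<tau> n t = enat k) \<partial>P)"
    by (intro Bochner_Integration.integral_sum integrable_pinning_weight_times) auto
  finally show ?thesis .
qed

lemma pinning_weight_next:
  assumes "regular_path t" "\<tau> n t = enat k" "\<tau> (Suc n) t = enat N"
  shows "pinning_weight \<tau> \<beta> h v N t = exp (h + \<beta> * v N) * pinning_weight \<tau> \<beta> h v k t"
proof -
  let ?f = "\<lambda>j. (h + \<beta> * v j) * indicator (renewal_set \<tau> t) j"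
  have "k < N" using renewal_less[OF assms(1,3), of n] assms(2) by auto
  then have "sum ?f {1..N} = sum ?f (insert N {1..k})"
    using renewal_set_between[OF assms] by (intro sum.mono_neutral_right) auto
  also have "\<dots> = ?f N + sum ?f {1..k}"
    by (rule sum.insert) (use \<open>k < N\<close> in auto)
  also have "?f N = h + \<beta> * v N"
  proof -
    have "N \<in> renewal_set \<tau> t" using assms(3) by (auto simp: renewal_set_def)
    then show ?thesis by simp
  qed
  finally show ?thesis by (simp add: pinning_weight_def exp_add mult.commute)
qed

text \<open>
  Decompose a path with a contact at \<open>N\<close> according to the index and the position of the preceding contact.
\<close>

lemma constrained_pf_recursion:
  assumes "N \<ge> 1"
  shows "constrained_pf \<beta> h v N =
    (\<Sum>k<N. constrained_pf \<beta> h v k * gap_prob (N - k)) * exp (h + \<beta> * v N)"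
proof -
  let ?e = "exp (h + \<beta> * v N)"
  let ?w = "pinning_weight \<tau> \<beta> h v"
  have "constrained_pf \<beta> h v N = (\<integral>t. (\<Sum>n<N. \<Sum>k<N.
      ?w k t * of_bool (\<tau> n t = enat k \<and> \<tau> (Suc n) t = enat (k + (N - k))) * ?e) \<partial>P)"
    unfolding constrained_pf_def
  proof (rule integral_cong_AE)
    show "AE t in P. ?w N t * indicator (renewal_set \<tau> t) N = (\<Sum>n<N. \<Sum>k<N.
        ?w k t * of_bool (\<tau> n t = enat k \<and> \<tau> (Suc n) t = enat (k + (N - k))) * ?e)"
      using AE_regular_path
    proof eventually_elim
      case (elim t)
      have "indicator (renewal_set \<tau> t) N = (\<Sum>n<Suc N. of_bool (\<tau> n t = enat N) :: real)"
        by (rule indicator_renewal_set[OF elim]) simp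
      also have "\<dots> = (\<Sum>n<N. of_bool (\<tau> (Suc n) t = enat N))"
        using elim assms
        by (subst sum.lessThan_Suc_shift) (auto simp: regular_path_def zero_enat_def)
      finally have "?w N t * indicator (renewal_set \<tau> t) N =
          (\<Sum>n<N. ?w N t * of_bool (\<tau> (Suc n) t = enat N))"
        by (simp add: sum_distrib_left)
      also have "\<dots> = (\<Sum>n<N. \<Sum>k<N. ?w k t *
          of_bool (\<tau> n t = enat k \<and> \<tau> (Suc n) t = enat (k + (N - k))) * ?e)"
      proof (rule sum.cong)
        fix n
        show "?w N t * of_bool (\<tau> (Suc n) t = enat N) = (\<Sum>k<N. ?w k t *
          of_bool (\<tau> n t = enat k \<and> \<tau> (Suc n) t = enat (k + (N - k))) * ?e)"
        proof (cases "\<tau> (Suc n) t = enat N")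
          case True
          then obtain k0 where k0: "k0 < N" "\<tau> n t = enat k0"
            using renewal_less[OF elim True, of n] by auto
          have "(\<Sum>k<N. ?w k t *
              of_bool (\<tau> n t = enat k \<and> \<tau> (Suc n) t = enat (k + (N - k))) * ?e) =
              (\<Sum>k<N. if k = k0 then ?w k t * ?e else 0)"
            by (intro sum.cong) (use k0 True in auto)
          also have "\<dots> = ?w k0 t * ?e" using k0 by simp
          also have "\<dots> = ?w N t" using pinning_weight_next[OF elim k0(2) True] by simp
          finally show ?thesis using True by simp
        qed (auto intro!: sum.neutral[symmetric])
      qed simp
      finally show ?case .
    qed
  qed measurable
  also have "\<dots> = (\<Sum>n<N. \<Sum>k<N.
      (\<integral>t. ?w k t * of_bool (\<tau> n t = enat k \<and> \<tau> (Suc n) t = enat (k + (N - k))) \<partial>P) * ?e)"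
    by (subst Bochner_Integration.integral_sum;
        (intro sum.cong refl, subst Bochner_Integration.integral_sum)?)
       (auto intro!: Bochner_Integration.integrable_sum integrable_mult_left
          integrable_pinning_weight_times)
  also have "\<dots> = (\<Sum>k<N. \<Sum>n<N. gap_prob (N - k) *
      (\<integral>t. ?w k t * of_bool (\<tau> n t = enat k) \<partial>P) * ?e)"
    unfolding pinning_weight_times_next_gap by (rule sum.swap)
  also have "\<dots> = (\<Sum>k<N. constrained_pf \<beta> h v k * gap_prob (N - k) * ?e)"
    by (intro sum.cong refl) (simp add: constrained_pf_eq_sum[of _ N] sum_distrib_left sum_distrib_right mult_ac)
  finally show ?thesis by (simp add: sum_distrib_right)
qed

lemma gap_prob_nonneg: "gap_prob n \<ge> 0"
  by (simp add: gap_prob_def)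

lemma constrained_pf_nonneg: "constrained_pf \<beta> h v N \<ge> 0"
  unfolding constrained_pf_def
  by (intro Bochner_Integration.integral_nonneg mult_nonneg_nonneg less_imp_le[OF pinning_weight_pos]) auto

lemma constrained_pf_0: "constrained_pf \<beta> h v 0 = 1"
proof -
  have "constrained_pf \<beta> h v 0 = (\<integral>t. 1 \<partial>P)"
    unfolding constrained_pf_def
  proof (rule integral_cong_AE)
    show "AE t in P. pinning_weight \<tau> \<beta> h v 0 t * indicator (renewal_set \<tau> t) 0 = 1"
      using AE_regular_path
      by eventually_elim (simp add: pinning_weight_def zero_in_renewal_set)
  qed measurable
  then show ?thesis by (simp add: P.prob_space)
qed

lemma constrained_pf_ge_jump:
  assumes "k < N"
  shows "constrained_pf \<beta> h v N \<ge> constrained_pf \<beta> h v k * gap_prob (N - k) * exp (h + \<beta> * v N)"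
proof -
  have "constrained_pf \<beta> h v k * gap_prob (N - k) \<le> (\<Sum>k<N. constrained_pf \<beta> h v k * gap_prob (N - k))"
    using assms by (intro member_le_sum) (auto intro!: mult_nonneg_nonneg constrained_pf_nonneg gap_prob_nonneg)
  with assms show ?thesis by (simp add: constrained_pf_recursion mult_right_mono)
qed

text \<open>
  Paths with a contact at \<open>N\<close> form part of all paths with a contact at \<open>N + M\<close>. Formally, dropping from the
  recursion for \<open>N + M\<close> the terms with last contact before \<open>N\<close> leaves the recursion for the shifted system
  of size \<open>M\<close>, multiplied by the constrained partition function of size \<open>N\<close>.
\<close>

lemma constrained_pf_supermultiplicative:
  "constrained_pf \<beta> h v (N + M) \<ge> constrained_pf \<beta> h v N * constrained_pf \<beta> h (\<lambda>n. v (N + n)) M"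
proof (induction M rule: less_induct)
  case (less M)
  show ?case
  proof (cases "M = 0")
    case True
    then show ?thesis by (simp add: constrained_pf_0)
  next
    case False
    let ?Z = "constrained_pf \<beta> h v" and ?Y = "constrained_pf \<beta> h (\<lambda>n. v (N + n))"
    have "?Z N * ?Y M = (\<Sum>j<M. ?Z N * ?Y j * gap_prob (M - j)) * exp (h + \<beta> * v (N + M))"
      using False by (simp add: constrained_pf_recursion[of M] sum_distrib_left mult_ac)
    also have "\<dots> \<le> (\<Sum>j<M. ?Z (N + j) * gap_prob (M - j)) * exp (h + \<beta> * v (N + M))"
      by (intro mult_right_mono sum_mono less.IH gap_prob_nonneg) auto
    also have "(\<Sum>j<M. ?Z (N + j) * gap_prob (M - j)) = (\<Sum>k\<in>{N..<N + M}. ?Z k * gap_prob (N + M - k))"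
      by (rule sum.reindex_bij_witness[of _ "\<lambda>k. k - N" "\<lambda>j. N + j"]) auto
    also have "\<dots> * exp (h + \<beta> * v (N + M)) \<le>
        (\<Sum>k<N + M. ?Z k * gap_prob (N + M - k)) * exp (h + \<beta> * v (N + M))"
      by (intro mult_right_mono sum_mono2) (auto intro!: mult_nonneg_nonneg constrained_pf_nonneg gap_prob_nonneg)
    also have "\<dots> = ?Z (N + M)"
      using False by (simp add: constrained_pf_recursion[of "N + M"])
    finally show ?thesis .
  qed
qed

lemma constrained_pf_le_partition_function:
  "constrained_pf \<beta> h v N \<le> partition_function P \<tau> \<beta> h v N"
  unfolding constrained_pf_def partition_function_def
  by (intro integral_mono integrable_pinning_weight_times integrable_pinning_weight)
     (auto simp: indicator_def less_imp_le[OF pinning_weight_pos])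

text \<open>
  The single term in which \<open>k\<close> is the last contact up to \<open>N\<close> equals the left-hand side.
\<close>

lemma pinning_weight_le_last_contact:
  assumes "regular_path t"
  shows "pinning_weight \<tau> \<beta> h v N t \<le>
    (\<Sum>k\<le>N. pinning_weight \<tau> \<beta> h v k t * indicator (renewal_set \<tau> t) k)"
proof -
  define A where "A = renewal_set \<tau> t \<inter> {..N}"
  define k where "k = Max A"
  have "finite A" "A \<noteq> {}" using zero_in_renewal_set[OF assms] by (auto simp: A_def)
  then have k: "k \<in> A" and max: "\<And>j. j \<in> A \<Longrightarrow> j \<le> k" by (auto simp: k_def)
  have notin: "j \<notin> renewal_set \<tau> t" if "k < j" "j \<le> N" for j
    using max[of j] that by (auto simp: A_def)
  let ?f = "\<lambda>j. (h + \<beta> * v j) * indicator (renewal_set \<tau> t) j"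
  have "sum ?f {1..N} = sum ?f {1..k}"
    using k notin by (intro sum.mono_neutral_right) (auto simp: A_def)
  then have "pinning_weight \<tau> \<beta> h v N t = pinning_weight \<tau> \<beta> h v k t * indicator (renewal_set \<tau> t) k"
    using k by (simp add: pinning_weight_def A_def)
  also have "\<dots> \<le> (\<Sum>k\<le>N. pinning_weight \<tau> \<beta> h v k t * indicator (renewal_set \<tau> t) k)"
    using k by (intro member_le_sum) (auto simp: A_def intro!: mult_nonneg_nonneg less_imp_le[OF pinning_weight_pos])
  finally show ?thesis .
qed

lemma partition_function_le_sum_constrained_pf:
  "partition_function P \<tau> \<beta> h v N \<le> (\<Sum>k\<le>N. constrained_pf \<beta> h v k)"
proof -
  have int: "integrable P (\<lambda>t. pinning_weight \<tau> \<beta> h v k t * indicator (renewal_set \<tau> t) k)" for k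
    by (intro integrable_pinning_weight_times) auto
  have "partition_function P \<tau> \<beta> h v N \<le>
      (\<integral>t. (\<Sum>k\<le>N. pinning_weight \<tau> \<beta> h v k t * indicator (renewal_set \<tau> t) k) \<partial>P)"
    unfolding partition_function_def
  proof (rule integral_mono_AE)
    show "AE t in P. pinning_weight \<tau> \<beta> h v N t \<le>
        (\<Sum>k\<le>N. pinning_weight \<tau> \<beta> h v k t * indicator (renewal_set \<tau> t) k)"
      using AE_regular_path by eventually_elim (rule pinning_weight_le_last_contact)
  qed (intro Bochner_Integration.integrable_sum int integrable_pinning_weight)+
  also have "\<dots> = (\<Sum>k\<le>N. constrained_pf \<beta> h v k)"
    unfolding constrained_pf_def by (intro Bochner_Integration.integral_sum int)
  finally show ?thesis .
qed

lemma partition_function_le_exp: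
  assumes "\<beta> \<ge> 0"
  shows "partition_function P \<tau> \<beta> h v N \<le> exp (\<Sum>n=1..N. \<bar>h\<bar> + \<beta> * \<bar>v n\<bar>)"
proof -
  have "partition_function P \<tau> \<beta> h v N \<le> (\<integral>t. exp (\<Sum>n=1..N. \<bar>h\<bar> + \<beta> * \<bar>v n\<bar>) \<partial>P)"
    unfolding partition_function_def
    by (intro integral_mono integrable_pinning_weight pinning_weight_le assms) simp
  then show ?thesis by (simp add: P.prob_space)
qed

lemma partition_function_mono:
  assumes "h \<le> h'"
  shows "partition_function P \<tau> \<beta> h v N \<le> partition_function P \<tau> \<beta> h' v N"
  unfolding partition_function_def
  by (intro integral_mono integrable_pinning_weight)
     (auto simp: pinning_weight_def assms intro!: sum_mono mult_right_mono)

lemma pinning_weight_cong: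
  assumes "\<And>n. n \<in> {1..N} \<Longrightarrow> v n = v' n"
  shows "pinning_weight \<tau> \<beta> h v N = pinning_weight \<tau> \<beta> h v' N"
  unfolding pinning_weight_def using assms by (intro ext arg_cong[of _ _ exp] sum.cong) auto

lemma constrained_pf_cong:
  assumes "\<And>n. n \<in> {1..N} \<Longrightarrow> v n = v' n"
  shows "constrained_pf \<beta> h v N = constrained_pf \<beta> h v' N"
proof -
  have "pinning_weight \<tau> \<beta> h v N = pinning_weight \<tau> \<beta> h v' N"
    by (rule pinning_weight_cong) (rule assms)
  then show ?thesis by (simp add: constrained_pf_def)
qed

lemma pinning_weight_measurable_pair:
  assumes V: "\<And>n. n \<in> {1..N} \<Longrightarrow> (\<lambda>x. V x n) \<in> borel_measurable X"
  shows "(\<lambda>p. pinning_weight \<tau> \<beta> h (V (fst p)) N (snd p)) \<in> borel_measurable (X \<Otimes>\<^sub>M P)"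
proof -
  have "(\<lambda>p. (h + \<beta> * V (fst p) n) * indicator (renewal_set \<tau> (snd p)) n)
      \<in> borel_measurable (X \<Otimes>\<^sub>M P)" if "n \<in> {1..N}" for n
    using measurable_compose[OF measurable_fst V[OF that]]
      measurable_compose[OF measurable_snd indicator_renewal_set_measurable]
    by (intro borel_measurable_times borel_measurable_add borel_measurable_const)
  then have "(\<lambda>p. \<Sum>n=1..N. (h + \<beta> * V (fst p) n) * indicator (renewal_set \<tau> (snd p)) n)
      \<in> borel_measurable (X \<Otimes>\<^sub>M P)"
    by (rule borel_measurable_sum)
  then show ?thesis
    unfolding pinning_weight_def by (rule measurable_compose[OF _ borel_measurable_exp])
qed

lemma partition_function_measurable:
  assumes "\<And>n. n \<in> {1..N} \<Longrightarrow> (\<lambda>x. V x n) \<in> borel_measurable X"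
  shows "(\<lambda>x. partition_function P \<tau> \<beta> h (V x) N) \<in> borel_measurable X"
  unfolding partition_function_def
  by (intro P.borel_measurable_lebesgue_integral)
     (use pinning_weight_measurable_pair[OF assms] in \<open>simp add: case_prod_unfold\<close>)

lemma constrained_pf_measurable:
  assumes "\<And>n. n \<in> {1..N} \<Longrightarrow> (\<lambda>x. V x n) \<in> borel_measurable X"
  shows "(\<lambda>x. constrained_pf \<beta> h (V x) N) \<in> borel_measurable X"
  unfolding constrained_pf_def
proof (intro P.borel_measurable_lebesgue_integral)
  have "(\<lambda>p. indicator (renewal_set \<tau> (snd p)) N :: real) \<in> borel_measurable (X \<Otimes>\<^sub>M P)"
    using measurable_compose[OF measurable_snd indicator_renewal_set_measurable] .
  then show "(\<lambda>(x, t). pinning_weight \<tau> \<beta> h (V x) N t * indicator (renewal_set \<tau> t) N)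
      \<in> borel_measurable (X \<Otimes>\<^sub>M P)"
    unfolding case_prod_unfold by (intro borel_measurable_times pinning_weight_measurable_pair assms)
qed

lemma measure_pinning_measure:
  assumes "B \<in> sets P"
  shows "measure (pinning_measure P \<tau> \<beta> h v N) B =
    (\<integral>t. pinning_weight \<tau> \<beta> h v N t * indicator B t \<partial>P) / partition_function P \<tau> \<beta> h v N"
proof -
  let ?Z = "partition_function P \<tau> \<beta> h v N"
  have Z: "?Z \<ge> 0"
    using order_trans[OF constrained_pf_nonneg constrained_pf_le_partition_function] .
  have "measure (pinning_measure P \<tau> \<beta> h v N) B = (\<integral>t. indicator B t \<partial>pinning_measure P \<tau> \<beta> h v N)"
    using assms sets.sets_into_space[OF assms] by (simp add: pinning_measure_def Int_absorb2)
  also have "\<dots> = (\<integral>t. (pinning_weight \<tau> \<beta> h v N t / ?Z) * indicator B t \<partial>P)"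
    unfolding pinning_measure_def using assms Z
    by (subst integral_density) (auto intro!: divide_nonneg_nonneg less_imp_le[OF pinning_weight_pos])
  finally show ?thesis by simp
qed

section \<open>Effect of the field on paths with many contacts\<close>

text \<open>
  Each contact in \<open>[1, N]\<close> gains a factor \<open>exp \<delta>\<close>. The contact at \<open>0\<close> carries no weight although
  it is counted in \<open>renewal_set \<tau> t \<inter> {0..N}\<close>, whence the exponent \<open>x - 1\<close>.
\<close>

lemma partition_function_tilt:
  assumes mass: "measure (pinning_measure P \<tau> \<beta> h v N)
      {t \<in> space P. real (card (renewal_set \<tau> t \<inter> {0..N})) > x} > c"
    and c: "c > 0" and \<delta>: "\<delta> \<ge> 0"
  shows "partition_function P \<tau> \<beta> (h + \<delta>) v N \<ge> c * exp (\<delta> * (x - 1)) * partition_function P \<tau> \<beta> h v N"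
proof -
  define B where "B = {t \<in> space P. real (card (renewal_set \<tau> t \<inter> {0..N})) > x}"
  let ?Z = "partition_function P \<tau> \<beta> h v N"
  \<comment> \<open>A set that is not measurable has measure zero, so the mass assumption itself gives measurability.\<close>
  have "B \<in> sets (pinning_measure P \<tau> \<beta> h v N)"
  proof (rule ccontr)
    assume "B \<notin> sets (pinning_measure P \<tau> \<beta> h v N)"
    from measure_notin_sets[OF this] mass c show False by (simp add: B_def)
  qed
  then have B [measurable]: "B \<in> sets P" by (simp add: pinning_measure_def)
  have Z: "?Z \<ge> 0"
    using order_trans[OF constrained_pf_nonneg constrained_pf_le_partition_function] .
  have c': "c < (\<integral>t. pinning_weight \<tau> \<beta> h v N t * indicator B t \<partial>P) / ?Z"
    using mass unfolding B_def[symmetric] measure_pinning_measure[OF B] .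
  with c Z have "?Z > 0" by (cases "?Z = 0") auto
  with c' have "c * ?Z \<le> (\<integral>t. pinning_weight \<tau> \<beta> h v N t * indicator B t \<partial>P)"
    by (simp add: field_simps)
  then have "c * exp (\<delta> * (x - 1)) * ?Z \<le>
      (\<integral>t. pinning_weight \<tau> \<beta> h v N t * indicator B t \<partial>P) * exp (\<delta> * (x - 1))"
    by (simp add: mult_ac)
  also have "\<dots> = (\<integral>t. pinning_weight \<tau> \<beta> h v N t * indicator B t * exp (\<delta> * (x - 1)) \<partial>P)"
    by simp
  also have "\<dots> \<le> partition_function P \<tau> \<beta> (h + \<delta>) v N"
    unfolding partition_function_def
  proof (intro integral_mono integrable_pinning_weight integrable_mult_left integrable_pinning_weight_times)
    fix t
    let ?R = "renewal_set \<tau> t"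
    show "pinning_weight \<tau> \<beta> h v N t * indicator B t * exp (\<delta> * (x - 1)) \<le>
        pinning_weight \<tau> \<beta> (h + \<delta>) v N t"
    proof (cases "t \<in> B")
      case True
      have "?R \<inter> {0..N} \<subseteq> insert 0 (?R \<inter> {1..N})" by auto
      then have "card (?R \<inter> {0..N}) \<le> card (insert 0 (?R \<inter> {1..N}))"
        by (intro card_mono) auto
      also have "\<dots> \<le> Suc (card (?R \<inter> {1..N}))" by (rule card_insert_le_m1) auto
      finally have "x - 1 \<le> real (card (?R \<inter> {1..N}))"
        using True by (simp add: B_def)
      also have "\<dots> = (\<Sum>n=1..N. indicator ?R n)"
        by (simp add: sum.If_cases indicator_def Int_commute Int_def)
      finally have le: "x - 1 \<le> (\<Sum>n=1..N. indicator ?R n)" .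
      have "pinning_weight \<tau> \<beta> (h + \<delta>) v N t =
          pinning_weight \<tau> \<beta> h v N t * exp (\<delta> * (\<Sum>n=1..N. indicator ?R n))"
        unfolding pinning_weight_def exp_add[symmetric] sum_distrib_left sum.distrib[symmetric]
        by (intro arg_cong[of _ _ exp] sum.cong) (auto simp: algebra_simps)
      then show ?thesis
        using True le \<delta> by (simp add: mult_left_mono pinning_weight_pos)
    next
      case False
      then show ?thesis by (simp add: less_imp_le[OF pinning_weight_pos])
    qed
  qed (auto simp: indicator_def)
  finally show ?thesis .
qed

end

section \<open>Stationarity of the environment\<close>

context iid_environment
begin

lemma environment_measurable [measurable]: "n \<ge> 1 \<Longrightarrow> \<omega> n \<in> borel_measurable Q"
  using environment_indep by (auto simp: Q.indep_vars_def2)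

lemma environment_integrable_n: "n \<ge> 1 \<Longrightarrow> integrable Q (\<omega> n)"
  using environment_integrable(1) environment_ident[of n]
    integrable_distr_eq[OF environment_measurable[of n], of "\<lambda>x. x"]
    integrable_distr_eq[OF environment_measurable[of 1], of "\<lambda>x. x"] by simp

lemma environment_expectation:
  assumes "n \<ge> 1" "f \<in> borel_measurable borel"
  shows "(\<integral>w. f (\<omega> n w) \<partial>Q) = (\<integral>w. (f (\<omega> 1 w) :: real) \<partial>Q)"
  using environment_ident[of n] assms
    integral_distr[OF environment_measurable[of n], of f]
    integral_distr[OF environment_measurable[of 1], of f] by simp

text \<open>
  A block of \<open>M\<close> consecutive disorder variables has the same product law wherever it starts.
\<close>

lemma environment_stationary:
  fixes F :: "(nat \<Rightarrow> real) \<Rightarrow> real"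
  assumes F [measurable]: "F \<in> borel_measurable (\<Pi>\<^sub>M i\<in>{1..M}. borel)"
    and local: "\<And>v v'. (\<And>n. n \<in> {1..M} \<Longrightarrow> v n = v' n) \<Longrightarrow> F v = F v'"
  shows "(\<integral>w. F (\<lambda>n. \<omega> (N + n) w) \<partial>Q) = (\<integral>w. F (\<lambda>n. \<omega> n w) \<partial>Q)"
proof (cases "M = 0")
  case True
  then have "F v = F v'" for v v' by (intro local) auto
  then show ?thesis by metis
next
  case False
  let ?D = "distr Q borel (\<omega> 1)"
  have prob: "prob_space ?D" by (rule Q.prob_space_distr) simp
  have block: "(\<integral>w. F (\<lambda>n. \<omega> (K + n) w) \<partial>Q) = (\<integral>v. F v \<partial>(\<Pi>\<^sub>M i\<in>{1..M}. ?D))" for K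
  proof -
    let ?I = "{K + 1..K + M}"
    have "Q.indep_vars (\<lambda>_. borel) \<omega> ?I"
      by (rule Q.indep_vars_subset[OF environment_indep]) auto
    then have "distr Q (\<Pi>\<^sub>M i\<in>?I. borel) (\<lambda>w. \<lambda>i\<in>?I. \<omega> i w) = (\<Pi>\<^sub>M i\<in>?I. distr Q borel (\<omega> i))"
      using False by (subst (asm) Q.indep_vars_iff_distr_eq_PiM') auto
    also have "\<dots> = (\<Pi>\<^sub>M i\<in>?I. ?D)"
      by (intro PiM_cong refl environment_ident) auto
    finally have law: "distr Q (\<Pi>\<^sub>M i\<in>?I. borel) (\<lambda>w. \<lambda>i\<in>?I. \<omega> i w) = (\<Pi>\<^sub>M i\<in>?I. ?D)" .
    have sets_eq: "sets (\<Pi>\<^sub>M i\<in>J. ?D) = sets (\<Pi>\<^sub>M i\<in>J. borel)" for J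
      by (intro sets_PiM_cong) auto
    have shift: "distr (\<Pi>\<^sub>M i\<in>?I. ?D) (\<Pi>\<^sub>M i\<in>{1..M}. ?D) (\<lambda>v. \<lambda>n\<in>{1..M}. v (K + n)) =
        (\<Pi>\<^sub>M i\<in>{1..M}. ?D)"
      using distr_PiM_reindex[of ?I "\<lambda>_. ?D" "\<lambda>n. K + n" "{1..M}"] prob by (auto simp: inj_on_def)
    have FD [measurable]: "F \<in> borel_measurable (\<Pi>\<^sub>M i\<in>{1..M}. ?D)"
      using F by (subst measurable_cong_sets[OF sets_eq refl])
    have shift_meas: "(\<lambda>v. \<lambda>n\<in>{1..M}. v (K + n)) \<in> measurable (\<Pi>\<^sub>M i\<in>?I. ?D) (\<Pi>\<^sub>M i\<in>{1..M}. ?D)"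
      by (intro measurable_restrict measurable_component_singleton) auto
    have meas: "(\<lambda>w. \<lambda>i\<in>?I. \<omega> i w) \<in> measurable Q (\<Pi>\<^sub>M i\<in>?I. borel)"
      by (intro measurable_restrict environment_measurable) auto
    have "(\<integral>v. F v \<partial>(\<Pi>\<^sub>M i\<in>{1..M}. ?D)) =
        (\<integral>v. F (\<lambda>n\<in>{1..M}. v (K + n)) \<partial>(\<Pi>\<^sub>M i\<in>?I. ?D))"
      by (subst shift[symmetric], rule integral_distr[OF shift_meas]) measurable
    also have "\<dots> = (\<integral>w. F (\<lambda>n\<in>{1..M}. (\<lambda>i\<in>?I. \<omega> i w) (K + n)) \<partial>Q)"
      unfolding law[symmetric]
    proof (rule integral_distr[OF meas])
      show "(\<lambda>v. F (\<lambda>n\<in>{1..M}. v (K + n))) \<in> borel_measurable (\<Pi>\<^sub>M i\<in>?I. borel)"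
        using measurable_compose[OF shift_meas FD]
        by (simp only: measurable_cong_sets[OF sets_eq refl])
    qed
    also have "\<dots> = (\<integral>w. F (\<lambda>n. \<omega> (K + n) w) \<partial>Q)"
      by (intro Bochner_Integration.integral_cong local) auto
    finally show ?thesis ..
  qed
  show ?thesis using block[of N] block[of 0] by simp
qed

end

section \<open>Mean log-partition functions and the free energy\<close>

context pinning_model
begin

lemma gap_prob_eq: "n \<ge> 1 \<Longrightarrow> gap_prob n = L (real n) / real n powr (1 + \<alpha>)"
  by (simp only: gap_prob_def renewal_law)

lemma gap_prob_pos: "n \<ge> 1 \<Longrightarrow> gap_prob n > 0"
  using L_slowly_varying by (simp add: gap_prob_eq slowly_varying_def)

lemma ln_gap_prob_lower_bound:
  "\<exists>C\<ge>0. \<forall>n\<ge>1. ln (gap_prob n) \<ge> - C * (1 + ln (real n))"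
proof -
  obtain C where C: "C \<ge> 0" "\<And>n. n \<ge> (1::nat) \<Longrightarrow> ln (L (real n)) \<ge> - C * (1 + ln (real n))"
    using slowly_varying_ln_lower_bound[OF L_slowly_varying] by blast
  have "ln (gap_prob n) \<ge> - (C + 1 + \<alpha>) * (1 + ln (real n))" if n: "n \<ge> 1" for n
  proof -
    have "L (real n) > 0" using n L_slowly_varying by (simp add: slowly_varying_def)
    then have "ln (gap_prob n) = ln (L (real n)) - (1 + \<alpha>) * ln (real n)"
      using n by (simp add: gap_prob_eq ln_div ln_powr)
    with C(2)[OF n] alpha_pos show ?thesis by (simp add: algebra_simps)
  qed
  with C(1) alpha_pos show ?thesis by (intro exI[of _ "C + 1 + \<alpha>"]) auto
qed

text \<open>
  Only the paths that jump from \<open>0\<close> straight to \<open>N\<close> are kept. This is the lower bound that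
  makes the logarithms integrable and at most logarithmically negative in mean.
\<close>

lemma constrained_pf_ge_single_jump:
  assumes "N \<ge> 1"
  shows "constrained_pf \<beta> h v N \<ge> gap_prob N * exp (h + \<beta> * v N)"
  using constrained_pf_ge_jump[of 0 N \<beta> h v] assms by (simp add: constrained_pf_0)

lemma constrained_pf_pos: "constrained_pf \<beta> h v N > 0"
proof (cases "N = 0")
  case False
  then have "0 < gap_prob N * exp (h + \<beta> * v N)" by (simp add: gap_prob_pos)
  also have "\<dots> \<le> constrained_pf \<beta> h v N" using False by (intro constrained_pf_ge_single_jump) simp
  finally show ?thesis .
qed (simp add: constrained_pf_0)

lemma partition_function_pos: "partition_function P \<tau> \<beta> h v N > 0"
  using constrained_pf_pos constrained_pf_le_partition_function by (rule less_le_trans)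

lemma ln_constrained_pf_lower_bound:
  assumes "N \<ge> 1"
  shows "ln (constrained_pf \<beta> h v N) \<ge> ln (gap_prob N) + (h + \<beta> * v N)"
proof -
  have "ln (gap_prob N * exp (h + \<beta> * v N)) \<le> ln (constrained_pf \<beta> h v N)"
    using assms by (intro ln_mono constrained_pf_ge_single_jump) (simp_all add: gap_prob_pos)
  then show ?thesis using assms by (simp add: ln_mult gap_prob_pos less_imp_neq[symmetric])
qed

lemma ln_partition_function_le:
  assumes "\<beta> \<ge> 0"
  shows "ln (partition_function P \<tau> \<beta> h v N) \<le> (\<Sum>n=1..N. \<bar>h\<bar> + \<beta> * \<bar>v n\<bar>)"
  using partition_function_le_exp[OF assms] partition_function_pos
  by (metis exp_gt_zero ln_exp ln_mono)

lemma ln_constrained_pf_le_ln_partition_function: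
  "ln (constrained_pf \<beta> h v N) \<le> ln (partition_function P \<tau> \<beta> h v N)"
  by (intro ln_mono constrained_pf_pos partition_function_pos constrained_pf_le_partition_function)

lemma abs_le_if_between_ln_partition_functions:
  assumes "\<beta> \<ge> 0" "ln (constrained_pf \<beta> h v N) \<le> x" "x \<le> ln (partition_function P \<tau> \<beta> h v N)"
  shows "\<bar>x\<bar> \<le> \<bar>ln (gap_prob N)\<bar> + (\<Sum>n=1..N. \<bar>h\<bar> + \<beta> * \<bar>v n\<bar>)"
proof -
  let ?S = "\<Sum>n=1..N. \<bar>h\<bar> + \<beta> * \<bar>v n\<bar>"
  have S: "?S \<ge> 0" using assms(1) by (intro sum_nonneg) auto
  have "ln (constrained_pf \<beta> h v N) \<ge> - \<bar>ln (gap_prob N)\<bar> - ?S"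
  proof (cases "N = 0")
    case False
    then have "N \<ge> 1" by simp
    have "\<bar>h\<bar> + \<beta> * \<bar>v N\<bar> \<le> ?S"
      by (rule member_le_sum) (use False assms(1) in auto)
    moreover have "- (\<beta> * v N) \<le> \<beta> * \<bar>v N\<bar>"
      using mult_left_mono[OF _ assms(1), of "- v N" "\<bar>v N\<bar>"] by simp
    ultimately show ?thesis
      using ln_constrained_pf_lower_bound[OF \<open>N \<ge> 1\<close>, of h \<beta> v] by linarith
  qed (simp add: constrained_pf_0)
  with assms(2,3) ln_partition_function_le[OF assms(1), of h v N] S show ?thesis by linarith
qed

lemma integrable_between_ln_partition_functions:
  assumes "\<beta> \<ge> 0" "f \<in> borel_measurable Q"
    and "\<And>w. ln (constrained_pf \<beta> h (\<lambda>n. \<omega> n w) N) \<le> f w"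
    and "\<And>w. f w \<le> ln (partition_function P \<tau> \<beta> h (\<lambda>n. \<omega> n w) N)"
  shows "integrable Q f"
proof (rule Bochner_Integration.integrable_bound)
  show "integrable Q (\<lambda>w. \<bar>ln (gap_prob N)\<bar> + (\<Sum>n=1..N. \<bar>h\<bar> + \<beta> * \<bar>\<omega> n w\<bar>))"
    by (intro Bochner_Integration.integrable_add Bochner_Integration.integrable_sum
        integrable_mult_right integrable_abs environment_integrable_n) auto
  show "AE w in Q. norm (f w) \<le> norm (\<bar>ln (gap_prob N)\<bar> + (\<Sum>n=1..N. \<bar>h\<bar> + \<beta> * \<bar>\<omega> n w\<bar>))"
    using abs_le_if_between_ln_partition_functions[OF assms(1) assms(3,4)] by (auto intro: order_trans[OF _ abs_ge_self])
qed fact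

lemma integrable_ln_constrained_pf:
  "\<beta> \<ge> 0 \<Longrightarrow> integrable Q (\<lambda>w. ln (constrained_pf \<beta> h (\<lambda>n. \<omega> n w) N))"
  by (rule integrable_between_ln_partition_functions[where h = h and N = N])
     (auto intro!: borel_measurable_ln constrained_pf_measurable
        ln_constrained_pf_le_ln_partition_function)

lemma integrable_ln_partition_function:
  "\<beta> \<ge> 0 \<Longrightarrow> integrable Q (\<lambda>w. ln (partition_function P \<tau> \<beta> h (\<lambda>n. \<omega> n w) N))"
  by (rule integrable_between_ln_partition_functions[where h = h and N = N])
     (auto intro!: borel_measurable_ln partition_function_measurable
        ln_constrained_pf_le_ln_partition_function)

definition mean_ln_constrained :: "real \<Rightarrow> real \<Rightarrow> nat \<Rightarrow> real" where
  "mean_ln_constrained \<beta> h N = (\<integral>w. ln (constrained_pf \<beta> h (\<lambda>n. \<omega> n w) N) \<partial>Q)"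

definition mean_ln_partition :: "real \<Rightarrow> real \<Rightarrow> nat \<Rightarrow> real" where
  "mean_ln_partition \<beta> h N = (\<integral>w. ln (partition_function P \<tau> \<beta> h (\<lambda>n. \<omega> n w) N) \<partial>Q)"

text \<open>
  The shifted factor in \<open>constrained_pf_supermultiplicative\<close> has, by stationarity, the same mean logarithm
  as the unshifted one.
\<close>

lemma mean_ln_constrained_superadditive:
  assumes "\<beta> \<ge> 0"
  shows "mean_ln_constrained \<beta> h (N + M) \<ge> mean_ln_constrained \<beta> h N + mean_ln_constrained \<beta> h M"
proof -
  let ?Z = "constrained_pf \<beta> h"
  let ?F = "\<lambda>v. ln (?Z v M)"
  have stat: "(\<integral>w. ?F (\<lambda>n. \<omega> (N + n) w) \<partial>Q) = (\<integral>w. ?F (\<lambda>n. \<omega> n w) \<partial>Q)"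
  proof (rule environment_stationary)
    show "?F \<in> borel_measurable (\<Pi>\<^sub>M i\<in>{1..M}. borel)"
      by (intro borel_measurable_ln constrained_pf_measurable measurable_component_singleton)
    show "?F v = ?F v'" if "\<And>n. n \<in> {1..M} \<Longrightarrow> v n = v' n" for v v'
      using constrained_pf_cong[OF that] by simp
  qed
  have int: "integrable Q (\<lambda>w. ?F (\<lambda>n. \<omega> (N + n) w))"
  proof (rule Bochner_Integration.integrable_bound)
    show "integrable Q (\<lambda>w. \<bar>ln (gap_prob M)\<bar> + (\<Sum>n=1..M. \<bar>h\<bar> + \<beta> * \<bar>\<omega> (N + n) w\<bar>))"
      by (intro Bochner_Integration.integrable_add Bochner_Integration.integrable_sum
          integrable_mult_right integrable_abs environment_integrable_n) auto
    show "(\<lambda>w. ?F (\<lambda>n. \<omega> (N + n) w)) \<in> borel_measurable Q"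
      by (intro borel_measurable_ln constrained_pf_measurable environment_measurable) auto
    show "AE w in Q. norm (?F (\<lambda>n. \<omega> (N + n) w)) \<le>
        norm (\<bar>ln (gap_prob M)\<bar> + (\<Sum>n=1..M. \<bar>h\<bar> + \<beta> * \<bar>\<omega> (N + n) w\<bar>))"
    proof (rule AE_I2)
      fix w
      show "norm (?F (\<lambda>n. \<omega> (N + n) w)) \<le>
          norm (\<bar>ln (gap_prob M)\<bar> + (\<Sum>n=1..M. \<bar>h\<bar> + \<beta> * \<bar>\<omega> (N + n) w\<bar>))"
        using abs_le_if_between_ln_partition_functions[OF assms order.refl ln_constrained_pf_le_ln_partition_function,
            of h "\<lambda>n. \<omega> (N + n) w" M]
        unfolding real_norm_def by linarith
    qed
  qed
  have "ln (?Z v N) + ln (?Z (\<lambda>n. v (N + n)) M) \<le> ln (?Z v (N + M))" for v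
  proof -
    have "ln (?Z v N * ?Z (\<lambda>n. v (N + n)) M) \<le> ln (?Z v (N + M))"
      by (intro ln_mono mult_pos_pos constrained_pf_pos constrained_pf_supermultiplicative)
    then show ?thesis by (simp add: ln_mult constrained_pf_pos less_imp_neq[OF constrained_pf_pos, symmetric])
  qed
  then have "(\<integral>w. ln (?Z (\<lambda>n. \<omega> n w) N) + ?F (\<lambda>n. \<omega> (N + n) w) \<partial>Q) \<le>
      mean_ln_constrained \<beta> h (N + M)"
    unfolding mean_ln_constrained_def
    by (intro integral_mono Bochner_Integration.integrable_add int integrable_ln_constrained_pf assms) auto
  also have "(\<integral>w. ln (?Z (\<lambda>n. \<omega> n w) N) + ?F (\<lambda>n. \<omega> (N + n) w) \<partial>Q) =
      mean_ln_constrained \<beta> h N + mean_ln_constrained \<beta> h M"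
    by (subst Bochner_Integration.integral_add[OF integrable_ln_constrained_pf[OF assms] int])
       (simp add: mean_ln_constrained_def stat)
  finally show ?thesis .
qed

lemma mean_ln_constrained_le_partition:
  "\<beta> \<ge> 0 \<Longrightarrow> mean_ln_constrained \<beta> h N \<le> mean_ln_partition \<beta> h N"
  unfolding mean_ln_constrained_def mean_ln_partition_def
  by (intro integral_mono integrable_ln_constrained_pf integrable_ln_partition_function
      ln_constrained_pf_le_ln_partition_function)

lemma mean_ln_partition_le:
  assumes "\<beta> \<ge> 0"
  shows "mean_ln_partition \<beta> h N \<le> (\<bar>h\<bar> + \<beta> * (\<integral>w. \<bar>\<omega> 1 w\<bar> \<partial>Q)) * real N"
proof -
  have int: "integrable Q (\<lambda>w. \<bar>h\<bar> + \<beta> * \<bar>\<omega> n w\<bar>)" if "n \<in> {1..N}" for n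
    using that by (intro Bochner_Integration.integrable_add integrable_mult_right integrable_abs
        environment_integrable_n) auto
  have "mean_ln_partition \<beta> h N \<le> (\<integral>w. (\<Sum>n=1..N. \<bar>h\<bar> + \<beta> * \<bar>\<omega> n w\<bar>) \<partial>Q)"
    unfolding mean_ln_partition_def
    by (intro integral_mono integrable_ln_partition_function ln_partition_function_le assms
        Bochner_Integration.integrable_sum int)
  also have "\<dots> = (\<Sum>n=1..N. \<integral>w. \<bar>h\<bar> + \<beta> * \<bar>\<omega> n w\<bar> \<partial>Q)"
    by (intro Bochner_Integration.integral_sum int)
  also have "\<dots> = (\<Sum>n=1..N. \<bar>h\<bar> + \<beta> * (\<integral>w. \<bar>\<omega> 1 w\<bar> \<partial>Q))"
  proof (rule sum.cong)
    fix n assume n: "n \<in> {1..N}"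
    show "(\<integral>w. \<bar>h\<bar> + \<beta> * \<bar>\<omega> n w\<bar> \<partial>Q) = \<bar>h\<bar> + \<beta> * (\<integral>w. \<bar>\<omega> 1 w\<bar> \<partial>Q)"
      using environment_expectation[of n "\<lambda>x. \<bar>h\<bar> + \<beta> * \<bar>x\<bar>"] n environment_integrable(1)
      by (simp add: Q.prob_space)
  qed simp
  finally show ?thesis by (simp add: mult.commute)
qed

text \<open>
  Bound the free partition function by the sum over the position \<open>k\<close> of the last contact and let each path
  make one more jump, from \<open>k\<close> to \<open>N + 1\<close>. The landing point lies outside \<open>[1, N]\<close> and is the same for
  all \<open>k\<close>, so the jump costs a single disorder variable, whose mean vanishes.
\<close>

lemma ln_partition_function_le_constrained:
  assumes "C \<ge> 0" "\<And>n. n \<ge> 1 \<Longrightarrow> ln (gap_prob n) \<ge> - C * (1 + ln (real n))"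
  shows "ln (partition_function P \<tau> \<beta> h v N) + (h + \<beta> * v (Suc N)) - C * (1 + ln (real (Suc N)))
    \<le> ln (constrained_pf \<beta> h v (Suc N))"
proof -
  let ?k = "exp (- C * (1 + ln (real (Suc N))))" and ?e = "exp (h + \<beta> * v (Suc N))"
  have K: "?k \<le> gap_prob n" if "n \<ge> 1" "n \<le> Suc N" for n
  proof -
    have "- C * (1 + ln (real (Suc N))) \<le> - C * (1 + ln (real n))"
      using assms(1) that by (simp add: mult_left_mono)
    also have "\<dots> \<le> ln (gap_prob n)" using assms(2) that by blast
    finally have "?k \<le> exp (ln (gap_prob n))" by (simp only: exp_le_cancel_iff)
    then show ?thesis using gap_prob_pos[OF that(1)] by simp
  qed
  have "partition_function P \<tau> \<beta> h v N * ?e * ?k \<le> (\<Sum>k\<le>N. constrained_pf \<beta> h v k) * ?e * ?k"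
    by (intro mult_right_mono partition_function_le_sum_constrained_pf) auto
  also have "\<dots> = (\<Sum>k<Suc N. constrained_pf \<beta> h v k * ?k) * ?e"
    by (simp add: sum_distrib_right lessThan_Suc_atMost mult_ac)
  also have "\<dots> \<le> (\<Sum>k<Suc N. constrained_pf \<beta> h v k * gap_prob (Suc N - k)) * ?e"
    by (intro mult_right_mono sum_mono mult_left_mono K constrained_pf_nonneg) auto
  also have "\<dots> = constrained_pf \<beta> h v (Suc N)"
    by (subst constrained_pf_recursion[of "Suc N"]) auto
  finally have "ln (partition_function P \<tau> \<beta> h v N * ?e * ?k) \<le> ln (constrained_pf \<beta> h v (Suc N))"
    by (intro ln_mono) (auto simp: partition_function_pos constrained_pf_pos)
  moreover have "ln (partition_function P \<tau> \<beta> h v N * ?e * ?k) =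
      ln (partition_function P \<tau> \<beta> h v N) + (h + \<beta> * v (Suc N)) + - C * (1 + ln (real (Suc N)))"
    using partition_function_pos[of \<beta> h v N] by (simp only: ln_mult_pos mult_pos_pos exp_gt_zero ln_exp)
  ultimately show ?thesis by linarith
qed

lemma mean_ln_partition_le_constrained:
  assumes "\<beta> \<ge> 0" "C \<ge> 0" "\<And>n. n \<ge> 1 \<Longrightarrow> ln (gap_prob n) \<ge> - C * (1 + ln (real n))"
  shows "mean_ln_partition \<beta> h N + h - C * (1 + ln (real (Suc N))) \<le> mean_ln_constrained \<beta> h (Suc N)"
proof -
  have mean: "(\<integral>w. \<omega> (Suc N) w \<partial>Q) = 0"
    using environment_expectation[of "Suc N" "\<lambda>x. x"] environment_mean by simp
  have int: "integrable Q (\<lambda>w. ln (partition_function P \<tau> \<beta> h (\<lambda>n. \<omega> n w) N))"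
    "integrable Q (\<omega> (Suc N))"
    using assms(1) by (auto intro!: integrable_ln_partition_function environment_integrable_n)
  have "(\<integral>w. ln (partition_function P \<tau> \<beta> h (\<lambda>n. \<omega> n w) N) + (h + \<beta> * \<omega> (Suc N) w)
      - C * (1 + ln (real (Suc N))) \<partial>Q) \<le> mean_ln_constrained \<beta> h (Suc N)"
    unfolding mean_ln_constrained_def
    by (intro integral_mono integrable_ln_constrained_pf assms ln_partition_function_le_constrained
        Bochner_Integration.integrable_add Bochner_Integration.integrable_diff
        integrable_mult_right int Q.integrable_const)
  also have "(\<integral>w. ln (partition_function P \<tau> \<beta> h (\<lambda>n. \<omega> n w) N) + (h + \<beta> * \<omega> (Suc N) w)
      - C * (1 + ln (real (Suc N))) \<partial>Q) =
      mean_ln_partition \<beta> h N + h - C * (1 + ln (real (Suc N)))"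
    using int by (simp add: mean_ln_partition_def mean Q.prob_space)
  finally show ?thesis .
qed

text \<open>
  The free and the constrained mean log-partition functions differ by \<open>O(ln N)\<close>, up to a shift of \<open>N\<close> by
  one, so the limit of the free one exists and equals the limit that Fekete's lemma supplies for the
  constrained one.
\<close>

lemma quenched_free_energy_limit:
  assumes "\<beta> \<ge> 0"
  shows "(\<lambda>N. mean_ln_partition \<beta> h N / real N) \<longlonglongrightarrow> quenched_free_energy P \<tau> Q \<omega> \<beta> h"
    and "M \<ge> 1 \<Longrightarrow> mean_ln_constrained \<beta> h M / real M \<le> quenched_free_energy P \<tau> Q \<omega> \<beta> h"
proof -
  let ?a = "mean_ln_constrained \<beta> h"
  obtain l where l: "(\<lambda>n. ?a n / real n) \<longlonglongrightarrow> l" and le: "\<And>n. n \<ge> 1 \<Longrightarrow> ?a n / real n \<le> l"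
    using fekete_superadditive[of ?a, OF mean_ln_constrained_superadditive[OF assms]
        order_trans[OF mean_ln_constrained_le_partition[OF assms] mean_ln_partition_le[OF assms]]]
    by blast
  obtain C where C: "C \<ge> 0" "\<And>n. n \<ge> 1 \<Longrightarrow> ln (gap_prob n) \<ge> - C * (1 + ln (real n))"
    using ln_gap_prob_lower_bound by blast
  have "(\<lambda>N. mean_ln_partition \<beta> h N / real N) \<longlonglongrightarrow> l"
  proof (rule tendsto_sandwich)
    show "\<forall>\<^sub>F N in sequentially. ?a N / real N \<le> mean_ln_partition \<beta> h N / real N"
      using mean_ln_constrained_le_partition[OF assms] by (simp add: divide_right_mono)
    show "(\<lambda>N. ?a N / real N) \<longlonglongrightarrow> l" by (rule l)
    let ?u = "\<lambda>N. ?a (Suc N) / real (Suc N) * (real (Suc N) / real N) +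
        (C * (1 + ln (real (Suc N))) - h) / real N"
    show "\<forall>\<^sub>F N in sequentially. mean_ln_partition \<beta> h N / real N \<le> ?u N"
    proof (intro always_eventually allI)
      fix N
      have "mean_ln_partition \<beta> h N / real N \<le>
          (?a (Suc N) + (C * (1 + ln (real (Suc N))) - h)) / real N"
        using mean_ln_partition_le_constrained[OF assms C, of h N] by (intro divide_right_mono) auto
      also have "\<dots> = ?u N"
        by (simp add: add_divide_distrib diff_divide_distrib del: of_nat_Suc)
      finally show "mean_ln_partition \<beta> h N / real N \<le> ?u N" .
    qed
    have "(\<lambda>N. real (Suc N) / real N) \<longlonglongrightarrow> 1" by real_asymp
    moreover have "(\<lambda>N. (C * (1 + ln (real (Suc N))) - h) / real N) \<longlonglongrightarrow> 0" by real_asymp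
    ultimately have "?u \<longlonglongrightarrow> l * 1 + 0" by (intro tendsto_intros LIMSEQ_Suc[OF l])
    then show "?u \<longlonglongrightarrow> l" by simp
  qed
  moreover from this have "quenched_free_energy P \<tau> Q \<omega> \<beta> h = l"
    unfolding quenched_free_energy_def mean_ln_partition_def by (rule limI)
  ultimately show "(\<lambda>N. mean_ln_partition \<beta> h N / real N) \<longlonglongrightarrow> quenched_free_energy P \<tau> Q \<omega> \<beta> h"
    and "M \<ge> 1 \<Longrightarrow> ?a M / real M \<le> quenched_free_energy P \<tau> Q \<omega> \<beta> h"
    using le by auto
qed

lemma ln_partition_function_mono:
  "h \<le> h' \<Longrightarrow> ln (partition_function P \<tau> \<beta> h v N) \<le> ln (partition_function P \<tau> \<beta> h' v N)"
  by (intro ln_mono partition_function_pos partition_function_mono)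

lemma quenched_free_energy_mono:
  assumes "\<beta> \<ge> 0" "h \<le> h'"
  shows "quenched_free_energy P \<tau> Q \<omega> \<beta> h \<le> quenched_free_energy P \<tau> Q \<omega> \<beta> h'"
proof (rule LIMSEQ_le[OF quenched_free_energy_limit(1) quenched_free_energy_limit(1)])
  have "mean_ln_partition \<beta> h N \<le> mean_ln_partition \<beta> h' N" for N
    unfolding mean_ln_partition_def
    by (intro integral_mono integrable_ln_partition_function ln_partition_function_mono assms)
  then show "\<exists>N. \<forall>n\<ge>N. mean_ln_partition \<beta> h n / real n \<le> mean_ln_partition \<beta> h' n / real n"
    by (auto intro!: divide_right_mono)
qed (fact assms(1))+

text \<open>
  On the environments in the event of \<open>many_contacts_prob\<close> the logarithm grows as in
  \<open>partition_function_tilt\<close>; on all others it does not decrease.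
\<close>

lemma mean_ln_partition_gain:
  assumes "\<beta> \<ge> 0" "N \<ge> 1" "\<gamma> > 0" "\<delta> \<ge> 0" "c > 0"
    and many: "many_contacts_prob P \<tau> Q \<omega> \<beta> h \<gamma> c N > c"
  shows "mean_ln_partition \<beta> (h + \<delta>) N \<ge>
    mean_ln_partition \<beta> h N + c * (\<delta> * (real N powr \<gamma> - 1)) + ln c"
proof -
  let ?Z = "\<lambda>h w. partition_function P \<tau> \<beta> h (\<lambda>n. \<omega> n w) N"
  define A where "A = {w \<in> space Q. measure (pinning_measure P \<tau> \<beta> h (\<lambda>n. \<omega> n w) N)
         {t \<in> space P. real (card (renewal_set \<tau> t \<inter> {0..N})) > real N powr \<gamma>} > c}"
  define x where "x = \<delta> * (real N powr \<gamma> - 1)"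
  have QA: "Q.prob A > c" using many by (simp add: many_contacts_prob_def A_def)
  have A [measurable]: "A \<in> sets Q"
  proof (rule ccontr)
    assume "A \<notin> sets Q"
    from measure_notin_sets[OF this] QA assms(5) show False by simp
  qed
  \<comment> \<open>Since \<open>ln c < 0\<close>, its coefficient \<open>Q.prob A\<close> may be replaced by \<open>1\<close>.\<close>
  have "c < 1" using QA Q.prob_le_1[of A] by linarith
  have "x \<ge> 0" using assms ge_one_powr_ge_zero[of "real N" \<gamma>] by (simp add: x_def)
  have ge: "ln (?Z h w) + (ln c + x) * indicator A w \<le> ln (?Z (h + \<delta>) w)" for w
  proof (cases "w \<in> A")
    case True
    then have "c * exp x * ?Z h w \<le> ?Z (h + \<delta>) w"
      unfolding x_def A_def using assms by (intro partition_function_tilt) auto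
    then have "ln (c * exp x * ?Z h w) \<le> ln (?Z (h + \<delta>) w)"
      using assms(5) by (intro ln_mono) (auto simp: partition_function_pos)
    moreover have "ln (c * exp x * ?Z h w) = ln c + x + ln (?Z h w)"
      using assms(5) partition_function_pos by (simp only: ln_mult_pos mult_pos_pos exp_gt_zero ln_exp)
    ultimately show ?thesis using True by simp
  next
    case False
    then show ?thesis using ln_partition_function_mono[of h "h + \<delta>"] assms(4) by simp
  qed
  have "mean_ln_partition \<beta> h N + (ln c + x) * Q.prob A =
      (\<integral>w. ln (?Z h w) + (ln c + x) * indicator A w \<partial>Q)"
    unfolding mean_ln_partition_def
    by (subst Bochner_Integration.integral_add)
       (auto intro!: integrable_ln_partition_function assms simp: Q.emeasure_eq_measure)
  also have "\<dots> \<le> mean_ln_partition \<beta> (h + \<delta>) N"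
    unfolding mean_ln_partition_def
    by (intro integral_mono ge integrable_ln_partition_function assms Bochner_Integration.integrable_add
        integrable_mult_right) (auto simp: Q.emeasure_eq_measure)
  finally have "mean_ln_partition \<beta> h N + (ln c + x) * Q.prob A \<le> mean_ln_partition \<beta> (h + \<delta>) N" .
  moreover have "c * x \<le> Q.prob A * x" using QA \<open>x \<ge> 0\<close> by (intro mult_right_mono) auto
  moreover have "ln c * 1 \<le> ln c * Q.prob A"
    using \<open>c < 1\<close> assms(5) by (intro mult_left_mono_neg) (auto simp: ln_le_zero_iff)
  ultimately show ?thesis by (simp add: x_def algebra_simps)
qed

text \<open>
  Chain the lower bound on the mean at \<open>h\<close> (a single jump), the gain from the tilt, and the passage to the
  constrained system of size \<open>N + 1\<close>. All losses are logarithmic in \<open>N\<close> and uniform in \<open>\<delta>\<close>.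
\<close>

lemma quenched_free_energy_gain:
  assumes "\<beta> \<ge> 0" "\<gamma> > 0" "c > 0"
  shows "\<exists>C. \<forall>N\<ge>1. \<forall>\<delta>\<ge>0. many_contacts_prob P \<tau> Q \<omega> \<beta> h \<gamma> c N > c \<longrightarrow>
    (c * (\<delta> * (real N powr \<gamma> - 1)) - C * (1 + ln (real (Suc N)))) / real (Suc N)
      \<le> quenched_free_energy P \<tau> Q \<omega> \<beta> (h + \<delta>)"
proof -
  obtain C where C: "C \<ge> 0" "\<And>n. n \<ge> 1 \<Longrightarrow> ln (gap_prob n) \<ge> - C * (1 + ln (real n))"
    using ln_gap_prob_lower_bound by blast
  define D where "D = 2 * C + 2 * \<bar>h\<bar> + \<bar>ln c\<bar>"
  have "(c * (\<delta> * (real N powr \<gamma> - 1)) - D * (1 + ln (real (Suc N)))) / real (Suc N)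
      \<le> quenched_free_energy P \<tau> Q \<omega> \<beta> (h + \<delta>)"
    if N: "N \<ge> 1" and \<delta>: "\<delta> \<ge> 0" and many: "many_contacts_prob P \<tau> Q \<omega> \<beta> h \<gamma> c N > c" for N \<delta>
  proof -
    let ?l = "1 + ln (real (Suc N))"
    have l: "?l \<ge> 1" by simp
    have "(\<integral>w. ln (gap_prob N) + (h + \<beta> * \<omega> N w) \<partial>Q) \<le> mean_ln_constrained \<beta> h N"
      unfolding mean_ln_constrained_def
      by (intro integral_mono ln_constrained_pf_lower_bound integrable_ln_constrained_pf assms N
          Bochner_Integration.integrable_add integrable_mult_right environment_integrable_n Q.integrable_const)
    moreover have "(\<integral>w. \<omega> N w \<partial>Q) = 0"
      using environment_expectation[of N "\<lambda>x. x"] environment_mean N by simp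
    ultimately have "ln (gap_prob N) + h \<le> mean_ln_constrained \<beta> h N"
      using environment_integrable_n[OF N] by (simp add: Q.prob_space)
    also have "\<dots> \<le> mean_ln_partition \<beta> h N"
      by (rule mean_ln_constrained_le_partition[OF assms(1)])
    finally have 1: "ln (gap_prob N) + h \<le> mean_ln_partition \<beta> h N" .
    have "C * (1 + ln (real N)) \<le> C * ?l" using C(1) N by (intro mult_left_mono) auto
    with C(2)[OF N] have 2: "- (C * ?l) \<le> ln (gap_prob N)" by simp
    have "(2 * \<bar>h\<bar> + \<bar>ln c\<bar>) * 1 \<le> (2 * \<bar>h\<bar> + \<bar>ln c\<bar>) * ?l" using l by (intro mult_left_mono) auto
    then have 3: "2 * (C * ?l) + 2 * \<bar>h\<bar> + \<bar>ln c\<bar> \<le> D * ?l"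
      unfolding D_def by (simp only: distrib_right mult.assoc)
    have "c * (\<delta> * (real N powr \<gamma> - 1)) - D * ?l \<le> mean_ln_constrained \<beta> (h + \<delta>) (Suc N)"
      using 1 2 3 \<delta> mean_ln_partition_gain[OF assms(1) N assms(2) \<delta> assms(3) many]
        mean_ln_partition_le_constrained[OF assms(1) C, of "h + \<delta>" N] by linarith
    then have "(c * (\<delta> * (real N powr \<gamma> - 1)) - D * ?l) / real (Suc N) \<le>
        mean_ln_constrained \<beta> (h + \<delta>) (Suc N) / real (Suc N)"
      by (rule divide_right_mono) simp
    also have "\<dots> \<le> quenched_free_energy P \<tau> Q \<omega> \<beta> (h + \<delta>)"
      by (rule quenched_free_energy_limit(2)[OF assms(1)]) simp
    finally show ?thesis .
  qed
  then show ?thesis by blast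
qed

section \<open>Behaviour of the free energy near the critical point\<close>

text \<open>
  With \<open>\<delta> = N powr (- 1/s)\<close> the gain \<open>\<delta> N powr \<gamma>\<close> is the power \<open>\<gamma> - 1/s > 0\<close> of \<open>N\<close>, which exceeds the
  logarithmic loss for large \<open>N\<close>.
\<close>

lemma quenched_free_energy_lower_bound:
  assumes "\<beta> \<ge> 0" "\<gamma> > 0" "c > 0" and s: "s > inverse \<gamma>"
  shows "\<forall>\<^sub>F N in sequentially. many_contacts_prob P \<tau> Q \<omega> \<beta> h \<gamma> c N > c \<longrightarrow>
    1 / real (Suc N) \<le> quenched_free_energy P \<tau> Q \<omega> \<beta> (h + real N powr (- inverse s))"
proof -
  obtain C where C: "\<And>N \<delta>. N \<ge> 1 \<Longrightarrow> \<delta> \<ge> 0 \<Longrightarrow> many_contacts_prob P \<tau> Q \<omega> \<beta> h \<gamma> c N > c \<Longrightarrow>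
    (c * (\<delta> * (real N powr \<gamma> - 1)) - C * (1 + ln (real (Suc N)))) / real (Suc N)
      \<le> quenched_free_energy P \<tau> Q \<omega> \<beta> (h + \<delta>)"
    using quenched_free_energy_gain[OF assms(1-3), of h] by blast
  define p where "p = inverse s"
  have "s > 0" using assms(2) s by (meson less_trans positive_imp_inverse_positive)
  then have p: "0 < p" "p < \<gamma>"
    using less_imp_inverse_less[OF s] assms(2) by (auto simp: p_def)
  have "filterlim (\<lambda>N. c * (real N powr (- p) * (real N powr \<gamma> - 1)) - C * (1 + ln (real (Suc N))))
      at_top sequentially"
    using p assms(3) by real_asymp
  then have "\<forall>\<^sub>F N in sequentially.
      1 \<le> c * (real N powr (- p) * (real N powr \<gamma> - 1)) - C * (1 + ln (real (Suc N)))"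
    by (auto simp: filterlim_at_top)
  then show ?thesis
    using eventually_ge_at_top[of 1]
  proof eventually_elim
    case (elim N)
    show ?case
    proof
      assume many: "many_contacts_prob P \<tau> Q \<omega> \<beta> h \<gamma> c N > c"
      have "1 / real (Suc N) \<le> (c * (real N powr (- p) * (real N powr \<gamma> - 1)) -
          C * (1 + ln (real (Suc N)))) / real (Suc N)"
        using elim(1) by (intro divide_right_mono) auto
      also have "\<dots> \<le> quenched_free_energy P \<tau> Q \<omega> \<beta> (h + real N powr (- p))"
        using elim(2) many by (intro C) auto
      finally show "1 / real (Suc N) \<le> quenched_free_energy P \<tau> Q \<omega> \<beta> (h + real N powr (- inverse s))"
        by (simp add: p_def)
    qed
  qed
qed

text \<open>
  For \<open>x > h\<close>, some \<open>N\<close> at which the contact condition holds is so large that \<open>h + N powr (- 1/s) < x\<close>, and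
  the free energy is positive there; monotonicity gives the sign on both sides of \<open>h\<close>.
\<close>

lemma quenched_critical_point_eq:
  assumes "\<beta> \<ge> 0" "\<gamma> > 0" "c > 0" and zero: "quenched_free_energy P \<tau> Q \<omega> \<beta> h = 0"
    and many: "\<exists>\<^sub>F N in sequentially. many_contacts_prob P \<tau> Q \<omega> \<beta> h \<gamma> c N > c"
  shows "quenched_critical_point P \<tau> Q \<omega> \<beta> = h"
proof -
  let ?f = "quenched_free_energy P \<tau> Q \<omega> \<beta>"
  define s where "s = inverse \<gamma> + 1"
  have s: "s > inverse \<gamma>" "s > 0" using assms(2) by (auto simp: s_def add_pos_pos)
  have "?f x > 0 \<longleftrightarrow> h < x" for x
  proof
    assume "h < x"
    have "(\<lambda>N. real N powr (- inverse s)) \<longlonglongrightarrow> 0" using s(2) by real_asymp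
    then have "\<forall>\<^sub>F N in sequentially. real N powr (- inverse s) < x - h"
      using \<open>h < x\<close> by (intro order_tendstoD(2)) auto
    then have "\<forall>\<^sub>F N in sequentially. many_contacts_prob P \<tau> Q \<omega> \<beta> h \<gamma> c N > c \<longrightarrow> ?f x > 0"
      using quenched_free_energy_lower_bound[OF assms(1-3) s(1), of h]
    proof eventually_elim
      case (elim N)
      have "0 < 1 / real (Suc N)" by simp
      moreover have "?f (h + real N powr (- inverse s)) \<le> ?f x"
        using elim(1) by (intro quenched_free_energy_mono assms) simp
      ultimately show ?case using elim(2) by linarith
    qed
    from frequently_mp[OF this many] show "?f x > 0" by simp
  next
    assume "?f x > 0"
    show "h < x"
    proof (rule ccontr)
      assume "\<not> h < x"
      then have "?f x \<le> ?f h" by (intro quenched_free_energy_mono assms) simp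
      with \<open>?f x > 0\<close> zero show False by simp
    qed
  qed
  then have "{x. ?f x > 0} = {h<..}" by auto
  then show ?thesis by (simp add: quenched_critical_point_def)
qed

text \<open>
  For small \<open>\<delta>\<close> take \<open>N = \<lceil>\<delta> powr (- s)\<rceil>\<close>. Then \<open>N powr (- 1/s) \<le> \<delta>\<close>, so monotonicity transfers the bound
  \<open>1 / (N + 1)\<close>, of order \<open>\<delta> powr s\<close>, to \<open>h + \<delta>\<close>.
\<close>

lemma Liminf_quenched_free_energy:
  assumes "\<beta> \<ge> 0" "\<gamma> > 0" "c > 0" and \<theta>: "\<theta> > inverse \<gamma>"
    and many: "\<forall>\<^sub>F N in sequentially. many_contacts_prob P \<tau> Q \<omega> \<beta> h \<gamma> c N > c"
  shows "Liminf (at_right h)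
    (\<lambda>x. ereal (quenched_free_energy P \<tau> Q \<omega> \<beta> x * (x - h) powr (- \<theta>))) = \<infinity>"
proof -
  let ?f = "quenched_free_energy P \<tau> Q \<omega> \<beta>"
  obtain s where s: "inverse \<gamma> < s" "s < \<theta>" using dense[OF \<theta>] by blast
  then have "s > 0" using assms(2) by (meson less_trans positive_imp_inverse_positive)
  have "\<forall>\<^sub>F N in sequentially. 1 / real (Suc N) \<le> ?f (h + real N powr (- inverse s))"
    using many quenched_free_energy_lower_bound[OF assms(1-3) s(1), of h]
    by eventually_elim simp
  then obtain N0 where N0: "\<And>N. N \<ge> N0 \<Longrightarrow> 1 / real (Suc N) \<le> ?f (h + real N powr (- inverse s))"
    by (auto simp: eventually_sequentially)
  have large: "\<forall>\<^sub>F \<delta> in at_right 0. K < ?f (h + \<delta>) * \<delta> powr (- \<theta>)" for K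
  proof -
    have "filterlim (\<lambda>\<delta>. \<delta> powr (- s)) at_top (at_right (0::real))"
      using \<open>s > 0\<close> by real_asymp
    then have "\<forall>\<^sub>F \<delta> in at_right 0. real N0 \<le> \<delta> powr (- s)"
      by (auto simp: filterlim_at_top)
    moreover have "filterlim (\<lambda>\<delta>. 1 / (\<delta> powr (- s) + 2) * \<delta> powr (- \<theta>)) at_top (at_right (0::real))"
      using \<open>s > 0\<close> s(2) by real_asymp
    then have "\<forall>\<^sub>F \<delta> in at_right 0. K < 1 / (\<delta> powr (- s) + 2) * \<delta> powr (- \<theta>)"
      by (auto simp: filterlim_at_top_dense)
    moreover have "\<forall>\<^sub>F \<delta> in at_right (0::real). \<delta> > 0" by (simp add: eventually_at_right_less)
    ultimately show ?thesis
    proof eventually_elim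
      case (elim \<delta>)
      define N where "N = nat \<lceil>\<delta> powr (- s)\<rceil>"
      have N: "\<delta> powr (- s) \<le> real N" "real N \<le> \<delta> powr (- s) + 1"
        using powr_ge_zero[of \<delta> "- s"] unfolding N_def by linarith+
      have pos: "\<delta> powr (- s) > 0" using elim(3) by simp
      have "real N powr (- inverse s) \<le> (\<delta> powr (- s)) powr (- inverse s)"
        using N(1) pos \<open>s > 0\<close> by (intro powr_mono2') auto
      also have "\<dots> = \<delta>" using elim(3) \<open>s > 0\<close> by (simp add: powr_powr)
      finally have le: "real N powr (- inverse s) \<le> \<delta>" .
      have "1 / (\<delta> powr (- s) + 2) \<le> 1 / real (Suc N)"
        using N(2) by (intro divide_left_mono) (auto intro!: mult_pos_pos add_nonneg_pos)
      also have "\<dots> \<le> ?f (h + real N powr (- inverse s))"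
        using elim(1) N(1) by (intro N0) linarith
      also have "\<dots> \<le> ?f (h + \<delta>)"
        using le by (intro quenched_free_energy_mono assms) simp
      finally have "1 / (\<delta> powr (- s) + 2) * \<delta> powr (- \<theta>) \<le> ?f (h + \<delta>) * \<delta> powr (- \<theta>)"
        by (rule mult_right_mono) simp
      with elim(2) show ?case by linarith
    qed
  qed
  have "\<infinity> \<le> Liminf (at_right h) (\<lambda>x. ereal (?f x * (x - h) powr (- \<theta>)))"
    unfolding le_Liminf_iff
  proof (intro allI impI)
    fix y :: ereal assume "y < \<infinity>"
    then obtain K where "y \<le> ereal K" by (cases y) auto
    then show "\<forall>\<^sub>F x in at_right h. y < ereal (?f x * (x - h) powr (- \<theta>))"
      unfolding eventually_at_right_to_0[of _ h] using large[of K]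
      by (auto elim!: eventually_mono simp: add.commute intro: le_less_trans)
  qed
  then show ?thesis by simp
qed

text \<open>
  Along the points \<open>h + N powr (- 1/s)\<close> for which the contact condition holds, the quotient is at least of
  order \<open>N powr (\<theta>/s - 1)\<close>, and \<open>\<theta>/s > 1\<close>.
\<close>

lemma Limsup_quenched_free_energy:
  assumes "\<beta> \<ge> 0" "\<gamma> > 0" "c > 0" and \<theta>: "\<theta> > inverse \<gamma>"
    and many: "\<exists>\<^sub>F N in sequentially. many_contacts_prob P \<tau> Q \<omega> \<beta> h \<gamma> c N > c"
  shows "Limsup (at_right h)
    (\<lambda>x. ereal (quenched_free_energy P \<tau> Q \<omega> \<beta> x * (x - h) powr (- \<theta>))) = \<infinity>"
proof (rule ccontr)
  let ?f = "quenched_free_energy P \<tau> Q \<omega> \<beta>"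
  assume "\<not> ?thesis"
  then have "Limsup (at_right h) (\<lambda>x. ereal (?f x * (x - h) powr (- \<theta>))) < \<infinity>"
    by (simp add: less_top[symmetric] top_ereal_def)
  then obtain K where "Limsup (at_right h) (\<lambda>x. ereal (?f x * (x - h) powr (- \<theta>))) < ereal K"
    using ereal_dense2 by blast
  then have bounded: "\<forall>\<^sub>F x in at_right h. ?f x * (x - h) powr (- \<theta>) < K"
    using Limsup_lessD by fastforce
  obtain s where s: "inverse \<gamma> < s" "s < \<theta>" using dense[OF \<theta>] by blast
  then have "s > 0" using assms(2) by (meson less_trans positive_imp_inverse_positive)
  define p where "p = inverse s"
  have p: "p > 0" "p * \<theta> > 1" using \<open>s > 0\<close> s(2) by (auto simp: p_def field_simps)
  have "filterlim (\<lambda>N. h + real N powr (- p)) (at_right h) sequentially"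
    using p(1) by real_asymp
  from eventually_compose_filterlim[OF bounded this]
  have "\<forall>\<^sub>F N in sequentially. ?f (h + real N powr (- p)) * (real N powr (- p)) powr (- \<theta>) < K"
    by simp
  moreover have "filterlim (\<lambda>N. 1 / real (Suc N) * real N powr (p * \<theta>)) at_top sequentially"
    using p(2) by real_asymp
  then have "\<forall>\<^sub>F N in sequentially. K \<le> 1 / real (Suc N) * real N powr (p * \<theta>)"
    by (auto simp: filterlim_at_top)
  ultimately have "\<forall>\<^sub>F N in sequentially. many_contacts_prob P \<tau> Q \<omega> \<beta> h \<gamma> c N > c \<longrightarrow> False"
    using quenched_free_energy_lower_bound[OF assms(1-3) s(1), of h]
  proof eventually_elim
    case (elim N)
    show ?case
    proof
      assume "many_contacts_prob P \<tau> Q \<omega> \<beta> h \<gamma> c N > c"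
      with elim(3) have "1 / real (Suc N) * real N powr (p * \<theta>) \<le>
          ?f (h + real N powr (- p)) * real N powr (p * \<theta>)"
        unfolding p_def by (intro mult_right_mono) auto
      with elim(1,2) show False by (simp add: powr_powr)
    qed
  qed
  from frequently_mp[OF this many] show False by simp
qed

end

theorem proposition1p3:
  fixes P :: "'t measure" and \<tau> :: "nat \<Rightarrow> 't \<Rightarrow> enat"
    and Q :: "'w measure" and \<omega> :: "nat \<Rightarrow> 'w \<Rightarrow> real"
    and \<alpha> \<gamma> \<beta> h\<^sub>0 :: real and L :: "real \<Rightarrow> real"
  assumes "pinning_model P \<tau> Q \<omega> \<alpha> L"
    and "\<gamma> > 0" and "\<beta> \<ge> 0"
    and "quenched_free_energy P \<tau> Q \<omega> \<beta> h\<^sub>0 = 0"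
  shows "((\<exists>c>0. liminf (\<lambda>N. ereal (many_contacts_prob P \<tau> Q \<omega> \<beta> h\<^sub>0 \<gamma> c N)) > ereal c) \<longrightarrow>
            quenched_critical_point P \<tau> Q \<omega> \<beta> = h\<^sub>0 \<and>
            (\<forall>\<theta>>inverse \<gamma>.
               Liminf (at_right h\<^sub>0)
                 (\<lambda>h. ereal (quenched_free_energy P \<tau> Q \<omega> \<beta> h * (h - h\<^sub>0) powr (- \<theta>))) = \<infinity>))
       \<and> ((\<exists>c>0. limsup (\<lambda>N. ereal (many_contacts_prob P \<tau> Q \<omega> \<beta> h\<^sub>0 \<gamma> c N)) > ereal c) \<longrightarrow>
            quenched_critical_point P \<tau> Q \<omega> \<beta> = h\<^sub>0 \<and>
            (\<forall>\<theta>>inverse \<gamma>.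
               Limsup (at_right h\<^sub>0)
                 (\<lambda>h. ereal (quenched_free_energy P \<tau> Q \<omega> \<beta> h * (h - h\<^sub>0) powr (- \<theta>))) = \<infinity>))"
proof -
  interpret pinning_model P \<tau> Q \<omega> \<alpha> L by fact
  let ?q = "\<lambda>c N. many_contacts_prob P \<tau> Q \<omega> \<beta> h\<^sub>0 \<gamma> c N"
  show ?thesis
  proof (intro conjI; intro impI; elim exE conjE)
    fix c :: real assume c: "c > 0" "liminf (\<lambda>N. ereal (?q c N)) > ereal c"
    then have ev: "\<forall>\<^sub>F N in sequentially. ?q c N > c"
      using less_LiminfD by fastforce
    then have "\<exists>\<^sub>F N in sequentially. ?q c N > c"
      by (simp add: eventually_frequently)
    with ev c show "quenched_critical_point P \<tau> Q \<omega> \<beta> = h\<^sub>0 \<and>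
        (\<forall>\<theta>>inverse \<gamma>. Liminf (at_right h\<^sub>0)
          (\<lambda>h. ereal (quenched_free_energy P \<tau> Q \<omega> \<beta> h * (h - h\<^sub>0) powr (- \<theta>))) = \<infinity>)"
      using assms quenched_critical_point_eq Liminf_quenched_free_energy by blast
  next
    fix c :: real assume c: "c > 0" "limsup (\<lambda>N. ereal (?q c N)) > ereal c"
    have fr: "\<exists>\<^sub>F N in sequentially. ?q c N > c"
    proof (rule ccontr)
      assume "\<not> ?thesis"
      then have "\<forall>\<^sub>F N in sequentially. ereal (?q c N) \<le> ereal c"
        by (simp add: not_frequently not_less)
      from Limsup_bounded[OF this] c(2) show False by simp
    qed
    with c show "quenched_critical_point P \<tau> Q \<omega> \<beta> = h\<^sub>0 \<and>
        (\<forall>\<theta>>inverse \<gamma>. Limsup (at_right h\<^sub>0)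
          (\<lambda>h. ereal (quenched_free_energy P \<tau> Q \<omega> \<beta> h * (h - h\<^sub>0) powr (- \<theta>))) = \<infinity>)"
      using assms quenched_critical_point_eq Limsup_quenched_free_energy by blast
  qed
qed

end
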